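(* There is a well-defined function $U$ from the set of coloured ribbon graphs to $\mathbb{Z}[\alpha,\beta,\gamma,a_{\mathrm{bs}},a_{\mathrm{bp}}^{1/2},a_{\mathrm{olc}},a_{\mathrm{olh}}^{1/2},b_{\mathrm{bs}},b_{\mathrm{bp}}^{1/2},b_{\mathrm{olc}},b_{\mathrm{olh}}^{1/2}]$ given by $$U(\mathbb{G})=\begin{cases}a_iU(\mathbb{G}\backslash e)+b_jU(\mathbb{G}/e)&\text{if } e \text{ is an edge of } \mathbb{G}\text{ of type }(i,j),\\ \alpha^n\beta^m\gamma^v&\text{if }\mathbb{G}\text{ is edgeless with } v \text{ vertices, } n \text{ vertex colour classes and } m \text{ boundary colour classes,}\end{cases}$$ where in the recursion $a_{\mathrm{nl}}=a_{\mathrm{bp}}^{1/2}a_{\mathrm{olh}}^{1/2}$ and $b_{\mathrm{nl}}=b_{\mathrm{bp}}^{1/2}b_{\mathrm{olh}}^{1/2}$; that is, evaluating $U(\mathbb{G})$ by repeatedly applying the recursion gives a result independent of the choices of edges.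
   Context: A ribbon graph $\mathbb{G}=(V(\mathbb{G}),E(\mathbb{G}))$ is a surface with boundary represented as a union of two finite sets of closed discs, vertices and edges, such that vertices and edges meet in disjoint line segments, each on the boundary of exactly one vertex and one edge, with every edge containing exactly two such segments. $F(\mathbb{G})$ is its set of boundary components. An edge is a loop if it meets one vertex; a loop is non-orientable if its union with its vertex is a Möbius band, and orientable otherwise. Deletion $\mathbb{G}\backslash e$ removes edge $e$; contraction $\mathbb{G}/e$: with $u,v$ the (not necessarily distinct) ends of $e$, glue a disc (a new vertex) along each boundary component of $e\cup u\cup v$ regarded as a curve on $\mathbb{G}$, then remove $e,u,v$. Thus contracting a non-loop merges its ends, contracting a non-orientable loop replaces its vertex by one vertex, contracting an orientable loop replaces its vertex by two vertices, and contraction does not change boundary components. For $A\subseteq E$, deletion/contraction of $A$ is done edge by edge (order independent); $e^c=E\setminus\{e\}$. A coloured ribbon graph is a ribbon graph with a partition of $V(\mathbb{G})$ into vertex colour classes and of $F(\mathbb{G})$ into boundary colour classes, up to equivalence (homeomorphisms preserving vertices, edges, orientation if orientable, and both partitions). Contraction of $e$: boundary classes unchanged; if distinct ends $u,v$ merge into $p$, the classes of $u,v$ merge into the single class $([u]\cup[v]\cup\{p\})\setminus\{u,v\}$; if $e$ is a non-orientable loop at $u$ producing $p$, $p$ replaces $u$ in its class; if $e$ is an orientable loop at $u$ producing $p,q$, both replace $u$ in its class; other vertices keep their classes. Deletion of $e$: vertex classes unchanged; if $e$ meets distinct boundary components $a,b$ merging into $r$, their classes merge into $([a]\cup[b]\cup\{r\})\setminus\{a,b\}$;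 if $e$ meets a single boundary component $a$ and one component $r$ results, $r$ replaces $a$; if two components $r,s$ result, both replace $a$ in its class; other boundary components keep their classes. Edge types: the five connected coloured ribbon graphs with one edge are: $\mathrm{bs}$, an edge joining two distinct vertices lying in different vertex colour classes; $\mathrm{bp}$, an edge joining two distinct vertices in the same vertex colour class; $\mathrm{olc}$, one vertex with an orientable loop whose two boundary components lie in different boundary colour classes; $\mathrm{olh}$, one vertex with an orientable loop whose two boundary components lie in the same boundary colour class; $\mathrm{nl}$, one vertex with a non-orientable loop. An edge $e$ of $\mathbb{G}$ is of type $(i,j)$, $i,j\in\{\mathrm{bs},\mathrm{bp},\mathrm{olc},\mathrm{olh},\mathrm{nl}\}$, if after removing isolated vertices $\mathbb{G}/e^c$ is $i$ and $\mathbb{G}\backslash e^c$ is $j$. *)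

theory Defs
  imports Main "HOL-Library.Disjoint_Sets" "HOL-Library.Poly_Mapping"
begin

section \<open>Ribbon graphs\<close>

text \<open>
  A ribbon graph is a surface glued from vertex discs and edge discs along disjoint line segments.
  We record it, up to homeomorphism, by the end points of these segments (the elements of
  \<open>pts\<close>) and three involutions that describe how the end points follow each other on the
  boundary circles of the discs:

  \<^item> \<open>seg x\<close> is the other end of the line segment (common to a vertex and an edge) ending at \<open>x\<close>;
  \<^item> \<open>side x\<close> is the other end of the free side, starting at \<open>x\<close>, of the edge disc containing \<open>x\<close>;
  \<^item> \<open>arc x\<close> is the other end of the free arc, starting at \<open>x\<close>, of the vertex disc containing \<open>x\<close>.

  The boundary circle of a vertex disc alternates \<open>arc\<close> and \<open>seg\<close>, that of an edge disc alternates
  \<open>seg\<close> and \<open>side\<close>, and a boundary component of the surface alternates \<open>arc\<close> and \<open>side\<close>.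
  An edge disc has four distinct points \<open>x, seg x, side x, seg (side x)\<close>.

  A vertex disc with no edge attached has no line segment on its boundary, so it would be invisible.
  We therefore also allow \<^emph>\<open>marks\<close>: pairs \<open>{x, y}\<close> with \<open>seg x = side x = y\<close>. A mark is a piece of
  the boundary circle of a vertex to which no edge is attached; vertex boundary and surface boundary
  both run along it. Every vertex carries at least one edge end or one mark. Marks have no
  topological meaning, and ribbon graphs that differ only in marks are equivalent (see
  \<open>drop_mark\<close> below).
\<close>

record 'a ribbon =
  pts :: "'a set"
  arc :: "'a \<Rightarrow> 'a"
  seg :: "'a \<Rightarrow> 'a"
  side :: "'a \<Rightarrow> 'a"

definition fpf_involution_on :: "'a set \<Rightarrow> ('a \<Rightarrow> 'a) \<Rightarrow> bool" where
  "fpf_involution_on P f \<longleftrightarrow> (\<forall>x\<in>P. f x \<in> P \<and> f x \<noteq> x \<and> f (f x) = x)"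

definition ribbon_graph :: "('a, 'z) ribbon_scheme \<Rightarrow> bool" where
  "ribbon_graph G \<longleftrightarrow>
     finite (pts G) \<and>
     fpf_involution_on (pts G) (arc G) \<and>
     fpf_involution_on (pts G) (seg G) \<and>
     fpf_involution_on (pts G) (side G) \<and>
     (\<forall>x\<in>pts G. seg G (side G x) = side G (seg G x))"

text \<open>The closed curves on \<open>P\<close> obtained by following \<open>f\<close> and \<open>g\<close>, each given by its set of points.\<close>

definition curves :: "'a set \<Rightarrow> ('a \<Rightarrow> 'a) \<Rightarrow> ('a \<Rightarrow> 'a) \<Rightarrow> 'a set set" where
  "curves P f g = P // ({(x, f x) |x. x \<in> P} \<union> {(x, g x) |x. x \<in> P})\<^sup>*"

definition verts :: "('a, 'z) ribbon_scheme \<Rightarrow> 'a set set" where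
  "verts G = curves (pts G) (arc G) (seg G)"

definition bounds :: "('a, 'z) ribbon_scheme \<Rightarrow> 'a set set" where
  "bounds G = curves (pts G) (arc G) (side G)"

definition edges :: "('a, 'z) ribbon_scheme \<Rightarrow> 'a set set" where
  "edges G = {{x, seg G x, side G x, seg G (side G x)} |x. x \<in> pts G \<and> seg G x \<noteq> side G x}"

text \<open>
  An orientation of the surface orients the boundary circles of all discs coherently.
  \<open>p x\<close> tells whether the free vertex arc at \<open>x\<close> leaves \<open>x\<close> or arrives at \<open>x\<close>; along the circles of
  vertex discs and edge discs, this must alternate. Of the surfaces made of one vertex and one loop,
  the annulus is orientable and the Moebius band is not.
\<close>

definition orientable :: "('a, 'z) ribbon_scheme \<Rightarrow> bool" where
  "orientable G \<longleftrightarrow>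
     (\<exists>p :: 'a \<Rightarrow> bool. \<forall>x\<in>pts G.
        p (arc G x) \<noteq> p x \<and> p (seg G x) \<noteq> p x \<and> p (side G x) \<noteq> p x)"


section \<open>Coloured ribbon graphs\<close>

record 'a coloured_ribbon = "'a ribbon" +
  vcol :: "'a set set set"
  bcol :: "'a set set set"

definition coloured_ribbon_graph :: "'a coloured_ribbon \<Rightarrow> bool" where
  "coloured_ribbon_graph G \<longleftrightarrow>
     ribbon_graph G \<and> partition_on (verts G) (vcol G) \<and> partition_on (bounds G) (bcol G)"

definition isomorphic :: "'a coloured_ribbon \<Rightarrow> 'a coloured_ribbon \<Rightarrow> bool" where
  "isomorphic G H \<longleftrightarrow>
     (\<exists>h. bij_betw h (pts G) (pts H) \<and>
          (\<forall>x\<in>pts G. h (arc G x) = arc H (h x) \<and> h (seg G x) = seg H (h x) \<and>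
                     h (side G x) = side H (h x)) \<and>
          vcol H = (\<lambda>c. (\<lambda>v. h ` v) ` c) ` vcol G \<and>
          bcol H = (\<lambda>c. (\<lambda>v. h ` v) ` c) ` bcol G)"

text \<open>
  Dropping the mark \<open>{x, y}\<close> joins the two arcs next to it. The mark must not be the only one on an
  edgeless vertex (\<open>arc x = y\<close>).
\<close>

definition drop_mark :: "'a coloured_ribbon \<Rightarrow> 'a coloured_ribbon \<Rightarrow> bool" where
  "drop_mark G H \<longleftrightarrow>
     (\<exists>x\<in>pts G. \<exists>y. seg G x = y \<and> side G x = y \<and> arc G x \<noteq> y \<and>
        H = \<lparr>pts = pts G - {x, y},
             arc = (arc G)(arc G x := arc G y, arc G y := arc G x),
             seg = seg G,
             side = side G,
             vcol = (\<lambda>c. (\<lambda>v. v - {x, y}) ` c) ` vcol G,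
             bcol = (\<lambda>c. (\<lambda>v. v - {x, y}) ` c) ` bcol G\<rparr>)"

definition equivalent :: "'a coloured_ribbon \<Rightarrow> 'a coloured_ribbon \<Rightarrow> bool" where
  "equivalent = equivclp (\<lambda>G H. coloured_ribbon_graph G \<and> coloured_ribbon_graph H \<and>
                                (isomorphic G H \<or> drop_mark G H))"


section \<open>Deletion and contraction\<close>

text \<open>
  \<open>recolour e S K\<close> is the effect on a colouring \<open>K\<close> (of the vertices or of the boundary components)
  of an operation at the edge \<open>e\<close> after which the coloured objects are \<open>S\<close>. Classes without an
  object meeting \<open>e\<close> stay; the classes with an object meeting \<open>e\<close> are united (there is only one of them
  unless \<open>e\<close> meets two objects, in different classes), and in the resulting class the old objects
  meeting \<open>e\<close> are replaced by the new ones. Here new objects are recognised by containing points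
  of \<open>e\<close>, which remain in the graph as marks.
\<close>

definition recolour :: "'a set \<Rightarrow> 'a set set \<Rightarrow> 'a set set set \<Rightarrow> 'a set set set" where
  "recolour e S K =
     {c \<in> K. \<forall>v\<in>c. v \<inter> e = {}} \<union>
     {{v \<in> \<Union>{c \<in> K. \<exists>w\<in>c. w \<inter> e \<noteq> {}}. v \<inter> e = {}} \<union> {v \<in> S. v \<inter> e \<noteq> {}}}"

text \<open>
  After deletion of \<open>e\<close> the surface boundary runs along the two segments of \<open>e\<close>, which become marks.
  Vertices and their classes do not change.
\<close>

definition delete :: "'a set \<Rightarrow> 'a coloured_ribbon \<Rightarrow> 'a coloured_ribbon" where
  "delete e G =
     (let G' = G\<lparr>side := (\<lambda>x. if x \<in> e then seg G x else side G x)\<rparr>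
      in G'\<lparr>bcol := recolour e (bounds G') (bcol G)\<rparr>)"

text \<open>
  Let \<open>u\<close>, \<open>v\<close> be the ends of \<open>e\<close>. The boundary components of the union of \<open>e\<close>, \<open>u\<close> and \<open>v\<close> run along
  the free sides of \<open>e\<close> instead of its segments. They bound the new vertex discs, on which
  the sides of \<open>e\<close> become marks. Boundary components and their classes do not change.
\<close>

definition contract :: "'a set \<Rightarrow> 'a coloured_ribbon \<Rightarrow> 'a coloured_ribbon" where
  "contract e G =
     (let G' = G\<lparr>seg := (\<lambda>x. if x \<in> e then side G x else seg G x)\<rparr>
      in G'\<lparr>vcol := recolour e (verts G') (vcol G)\<rparr>)"

text \<open>
  Edge by edge deletion and contraction of a set of edges, in some order. The points of the other
  edges are not affected, so they are still edges (as sets of points) of the intermediate graphs.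
\<close>

definition deletes_to :: "'a coloured_ribbon \<Rightarrow> 'a set set \<Rightarrow> 'a coloured_ribbon \<Rightarrow> bool" where
  "deletes_to G A H \<longleftrightarrow> (\<exists>es. distinct es \<and> set es = A \<and> H = fold delete es G)"

definition contracts_to :: "'a coloured_ribbon \<Rightarrow> 'a set set \<Rightarrow> 'a coloured_ribbon \<Rightarrow> bool" where
  "contracts_to G A H \<longleftrightarrow> (\<exists>es. distinct es \<and> set es = A \<and> H = fold contract es G)"


section \<open>Edge types\<close>

definition remove_isolated :: "'a coloured_ribbon \<Rightarrow> 'a coloured_ribbon" where
  "remove_isolated G =
     (let P = \<Union>{v \<in> verts G. \<exists>e\<in>edges G. v \<inter> e \<noteq> {}}
      in G\<lparr>pts := P,
           vcol := (\<lambda>c. {v \<in> c. v \<subseteq> P}) ` vcol G - {{}},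
           bcol := (\<lambda>c. {v \<in> c. v \<subseteq> P}) ` bcol G - {{}}\<rparr>)"

datatype edge_type = bs | bp | olc | olh | nl

text \<open>The five connected coloured ribbon graphs with one edge.\<close>

fun is_one_edge_graph :: "edge_type \<Rightarrow> 'a coloured_ribbon \<Rightarrow> bool" where
  "is_one_edge_graph bs G \<longleftrightarrow>
     (\<exists>e u v. edges G = {e} \<and> verts G = {u, v} \<and> u \<noteq> v \<and> u \<inter> e \<noteq> {} \<and> v \<inter> e \<noteq> {} \<and>
              vcol G = {{u}, {v}})"
| "is_one_edge_graph bp G \<longleftrightarrow>
     (\<exists>e u v. edges G = {e} \<and> verts G = {u, v} \<and> u \<noteq> v \<and> u \<inter> e \<noteq> {} \<and> v \<inter> e \<noteq> {} \<and>
              vcol G = {{u, v}})"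
| "is_one_edge_graph olc G \<longleftrightarrow>
     (\<exists>e u a b. edges G = {e} \<and> verts G = {u} \<and> orientable G \<and> bounds G = {a, b} \<and> a \<noteq> b \<and>
                bcol G = {{a}, {b}})"
| "is_one_edge_graph olh G \<longleftrightarrow>
     (\<exists>e u a b. edges G = {e} \<and> verts G = {u} \<and> orientable G \<and> bounds G = {a, b} \<and> a \<noteq> b \<and>
                bcol G = {{a, b}})"
| "is_one_edge_graph nl G \<longleftrightarrow>
     (\<exists>e u. edges G = {e} \<and> verts G = {u} \<and> \<not> orientable G)"

definition has_type :: "'a coloured_ribbon \<Rightarrow> 'a set \<Rightarrow> edge_type \<times> edge_type \<Rightarrow> bool" where
  "has_type G e = (\<lambda>(i, j). e \<in> edges G \<and>
     (\<exists>H. contracts_to G (edges G - {e}) H \<and> is_one_edge_graph i (remove_isolated H)) \<and>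
     (\<exists>H. deletes_to G (edges G - {e}) H \<and> is_one_edge_graph j (remove_isolated H)))"


section \<open>The polynomial ring and the recursion\<close>

datatype indet = Alpha | Beta | Gamma
  | A_bs | A_bp_half | A_olc | A_olh_half
  | B_bs | B_bp_half | B_olc | B_olh_half

text \<open>
  Finitely supported integer combinations of monomials, i.e. the polynomial ring over the integers
  in the above indeterminates; \<open>A_bp_half\<close> is the indeterminate $a_{bp}^{1/2}$, etc.
\<close>

type_synonym upoly = "(indet \<Rightarrow>\<^sub>0 nat) \<Rightarrow>\<^sub>0 int"

definition X :: "indet \<Rightarrow> upoly" where
  "X v = Poly_Mapping.single (Poly_Mapping.single v 1) 1"

fun coeff_a :: "edge_type \<Rightarrow> upoly" where
  "coeff_a bs = X A_bs"
| "coeff_a bp = (X A_bp_half)\<^sup>2"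
| "coeff_a olc = X A_olc"
| "coeff_a olh = (X A_olh_half)\<^sup>2"
| "coeff_a nl = X A_bp_half * X A_olh_half"

fun coeff_b :: "edge_type \<Rightarrow> upoly" where
  "coeff_b bs = X B_bs"
| "coeff_b bp = (X B_bp_half)\<^sup>2"
| "coeff_b olc = X B_olc"
| "coeff_b olh = (X B_olh_half)\<^sup>2"
| "coeff_b nl = X B_bp_half * X B_olh_half"

definition edgeless_value :: "'a coloured_ribbon \<Rightarrow> upoly" where
  "edgeless_value G =
     X Alpha ^ card (vcol G) * X Beta ^ card (bcol G) * X Gamma ^ card (verts G)"

text \<open>\<open>evaluates G p\<close>: some run of the recursion, with arbitrary choices of edges, yields \<open>p\<close>.\<close>

inductive evaluates :: "'a coloured_ribbon \<Rightarrow> upoly \<Rightarrow> bool" where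
  edgeless: "edges G = {} \<Longrightarrow> evaluates G (edgeless_value G)"
| recurse: "has_type G e (i, j) \<Longrightarrow> evaluates (delete e G) p \<Longrightarrow> evaluates (contract e G) q \<Longrightarrow>
            evaluates G (coeff_a i * p + coeff_b j * q)"

end

theory Submission
  imports Defs
begin

text \<open>
  For a set \<open>A\<close> of edges, contract \<open>A\<close> and delete the rest; let \<open>v(A)\<close>, \<open>n(A)\<close>, \<open>m(A)\<close> be the numbers
  of vertices, vertex colour classes and boundary colour classes of the result. Adding an edge \<open>e\<close> to
  \<open>A\<close> changes this triple in one of five ways, which are the types of \<open>e\<close> in the graph where all other
  edges have been contracted or deleted according to \<open>A\<close>. Hence the type \<open>(i, j)\<close> of \<open>e\<close> in \<open>G\<close> is read
  off the steps \<open>E - e \<rightarrow> E\<close> and \<open>\<emptyset> \<rightarrow> e\<close>, and the number of steps of each type on a chain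
  \<open>\<emptyset> \<rightarrow> A \<rightarrow> E\<close>, counting \<open>nl\<close> as half \<open>bp\<close> and half \<open>olh\<close>, depends only on the triples at
  \<open>\<emptyset>\<close>, \<open>A\<close> and \<open>E\<close>. So \<open>U\<close> is the sum over \<open>A\<close> of \<open>\<alpha>\<^sup>n \<beta>\<^sup>m \<gamma>\<^sup>v\<close> times the \<open>b\<close>-weight of
  \<open>\<emptyset> \<rightarrow> A\<close> and the \<open>a\<close>-weight of \<open>A \<rightarrow> E\<close>; the recursion splits the sum by \<open>e \<in> A\<close>.
\<close>

section \<open>Equivalence closures and their classes\<close>

text \<open>The obstacle is that vertices, boundary components and colour classes become different
  sets after each operation. Deletion and contraction keep the points, however, so \<open>v\<close>,
  \<open>n\<close> and \<open>m\<close> are all written as numbers of classes of relations on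
  \<open>pts G\<close>, where an edge merely adds or exchanges generators. The order of the
  operations then disappears from the counts, and comparing two counts comes down to whether one
  further pair merges two classes.

  The half powers are forced. Steps of type \<open>bs\<close>, \<open>bp\<close>,
  \<open>olc\<close>, \<open>olh\<close>, \<open>nl\<close> change (v, n, m) by (-1,-1,0), (-1,0,0),
  (1,0,1), (1,0,0), (0,0,0). With the number of steps this gives four linear equations for five
  multiplicities, and up to multiples the only relation left is that one \<open>bp\<close> and one
  \<open>olh\<close> have the effect of two \<open>nl\<close>. A weight that depends only on the end
  states and the number of steps must therefore give \<open>nl\<close> a square equal to the product
  for \<open>bp\<close> and \<open>olh\<close>.\<close>

definition conn :: "('a \<times> 'a) set \<Rightarrow> ('a \<times> 'a) set" where
  "conn R = (R \<union> R\<inverse>)\<^sup>*"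

lemma equiv_conn: "equiv UNIV (conn R)"
  unfolding conn_def
  by (intro equivI refl_rtrancl trans_rtrancl sym_rtrancl) (auto simp: sym_def)

lemma conn_refl [simp]: "(a, a) \<in> conn R"
  by (simp add: conn_def)

lemma conn_sym: "(a, b) \<in> conn R \<Longrightarrow> (b, a) \<in> conn R"
  using equiv_conn[of R] by (auto elim!: equivE dest: symD)

lemma conn_trans: "(a, b) \<in> conn R \<Longrightarrow> (b, c) \<in> conn R \<Longrightarrow> (a, c) \<in> conn R"
  using equiv_conn[of R] by (auto elim!: equivE dest: transD)

lemma conn_incl: "(a, b) \<in> R \<Longrightarrow> (a, b) \<in> conn R"
  unfolding conn_def by auto

lemma conn_least:
  assumes "R \<subseteq> S" "equiv UNIV S"
  shows "conn R \<subseteq> S"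
proof -
  have S: "R \<union> R\<inverse> \<subseteq> S" "refl S" "trans S"
    using assms by (auto elim!: equivE dest: symD)
  have "(a, b) \<in> S" if "(a, b) \<in> (R \<union> R\<inverse>)\<^sup>*" for a b
    using \<open>(a, b) \<in> _\<close>
  proof (induction rule: rtrancl_induct)
    case base
    show ?case using S(2) by (rule reflD)
  next
    case (step b c)
    then show ?case using S(1,3) by (blast dest: transD)
  qed
  then show ?thesis by (auto simp: conn_def)
qed

text \<open>The kernel of \<open>\<phi>\<close> is an equivalence relation containing
  \<open>R\<close>. Most later arguments along curves take this form, often with a truth value for
  \<open>\<phi>\<close>.\<close>

lemma conn_invariant:
  assumes "(a, b) \<in> conn R" "\<And>a b. (a, b) \<in> R \<Longrightarrow> \<phi> a = \<phi> b"
  shows "\<phi> a = \<phi> b"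
  using conn_least[of R "{(a, b). \<phi> a = \<phi> b}"] assms
  by (auto simp: equiv_def refl_on_def sym_def trans_def)

lemma conn_class_eq_iff: "conn R `` {a} = conn R `` {b} \<longleftrightarrow> (a, b) \<in> conn R"
  using eq_equiv_class_iff[OF equiv_conn] by simp

lemma conn_image:
  assumes "(a, b) \<in> conn R" "\<And>a b. (a, b) \<in> R \<Longrightarrow> (h a, h b) \<in> conn S"
  shows "(h a, h b) \<in> conn S"
  using conn_invariant[OF assms(1), of "\<lambda>a. conn S `` {h a}"] assms(2)
  by (simp add: conn_class_eq_iff)

lemma conn_subI: "(\<And>a b. (a, b) \<in> R \<Longrightarrow> (a, b) \<in> conn S) \<Longrightarrow> conn R \<subseteq> conn S"
  by (intro conn_least equiv_conn) auto

lemma conn_mono: "R \<subseteq> S \<Longrightarrow> conn R \<subseteq> conn S"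
  by (intro conn_subI conn_incl) auto

lemma conn_eqI:
  assumes "\<And>a b. (a, b) \<in> R \<Longrightarrow> (a, b) \<in> conn S"
    and "\<And>a b. (a, b) \<in> S \<Longrightarrow> (a, b) \<in> conn R"
  shows "conn R = conn S"
  using assms by (intro equalityI conn_subI) auto

lemma conn_conn_Un: "conn (conn R \<union> Q) = conn (R \<union> Q)"
  by (rule conn_eqI) (use conn_mono[of R "R \<union> Q"] in \<open>auto intro: conn_incl\<close>)

lemma conn_mem_iff: "(a, b) \<in> conn R \<Longrightarrow> R \<subseteq> P \<times> P \<Longrightarrow> a \<in> P \<longleftrightarrow> b \<in> P"
  by (rule conn_invariant[of a b R "\<lambda>a. a \<in> P"]) auto

lemma quotient_eq_image: "P // R = (\<lambda>x. R `` {x}) ` P"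
  by (auto simp: quotient_def)

lemma partition_on_quotient_conn:
  assumes "R \<subseteq> P \<times> P"
  shows "partition_on P (P // conn R)"
proof (rule partition_onI)
  show "\<Union> (P // conn R) = P"
    using conn_mem_iff[OF _ assms] by (auto simp: quotient_def intro: conn_refl)
  show "{} \<notin> P // conn R"
    using conn_refl[of _ R] unfolding quotient_def by blast
  show "disjnt p q" if "p \<in> P // conn R" "q \<in> P // conn R" "p \<noteq> q" for p q
  proof -
    obtain a b where ab: "p = conn R `` {a}" "q = conn R `` {b}"
      using \<open>p \<in> _\<close> \<open>q \<in> _\<close> by (auto simp: quotient_def)
    show ?thesis
    proof (rule ccontr)
      assume "\<not> disjnt p q"
      then obtain c where "(a, c) \<in> conn R" "(b, c) \<in> conn R"
        by (auto simp: ab disjnt_def)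
      then have "(a, b) \<in> conn R" by (blast intro: conn_sym conn_trans)
      then show False using that(3) unfolding ab by (simp add: conn_class_eq_iff)
    qed
  qed
qed

text \<open>\<open>h\<close> is only assumed to reflect connectedness, so it need not map classes
  into classes. The comparison runs backwards: all points that \<open>h\<close> sends into one class
  of \<open>R'\<close> are connected, and every class of \<open>R\<close> arises in this
  way.\<close>

lemma card_quotient_le:
  assumes "finite P'" "h ` P \<subseteq> P'"
    and "\<And>p q. p \<in> P \<Longrightarrow> q \<in> P \<Longrightarrow> (h p, h q) \<in> conn R' \<Longrightarrow> (p, q) \<in> conn R"
  shows "card (P // conn R) \<le> card (P' // conn R')"
proof (rule surj_card_le)
  show "finite (P' // conn R')" using assms(1) by (simp add: quotient_eq_image)
  let ?F = "\<lambda>c'. \<Union>{conn R `` {p} |p. p \<in> P \<and> h p \<in> c'}"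
  show "P // conn R \<subseteq> ?F ` (P' // conn R')"
  proof
    fix c assume "c \<in> P // conn R"
    then obtain p where p: "p \<in> P" "c = conn R `` {p}" by (auto simp: quotient_def)
    have "?F (conn R' `` {h p}) = c"
    proof (rule set_eqI)
      fix x
      have "x \<in> ?F (conn R' `` {h p}) \<longleftrightarrow> (\<exists>q\<in>P. (h p, h q) \<in> conn R' \<and> (q, x) \<in> conn R)"
        by auto
      also have "\<dots> \<longleftrightarrow> (p, x) \<in> conn R"
        using assms(3)[OF p(1)] p(1) conn_trans[of p _ R x] conn_refl[of p R] conn_refl[of "h p" R']
        by metis
      finally show "x \<in> ?F (conn R' `` {h p}) \<longleftrightarrow> x \<in> c" by (simp add: p(2))
    qed
    moreover have "conn R' `` {h p} \<in> P' // conn R'"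
      using assms(2) p(1) by (auto simp: quotient_def)
    ultimately show "c \<in> ?F ` (P' // conn R')" by blast
  qed
qed

text \<open>\<open>h\<close> and \<open>k\<close> are inverse to each other up to connectedness, so
  each reflects what the other preserves. A retraction together with an inclusion is enough; no
  bijection of points is asked for.\<close>

lemma card_quotient_eq:
  assumes "finite P" "finite P'" "h ` P \<subseteq> P'" "k ` P' \<subseteq> P"
    and R: "R \<subseteq> P \<times> P" "R' \<subseteq> P' \<times> P'"
    and h: "\<And>p q. (p, q) \<in> R \<Longrightarrow> (h p, h q) \<in> conn R'"
    and k: "\<And>p q. (p, q) \<in> R' \<Longrightarrow> (k p, k q) \<in> conn R"
    and kh: "\<And>p. p \<in> P \<Longrightarrow> (k (h p), p) \<in> conn R"
    and hk: "\<And>p. p \<in> P' \<Longrightarrow> (h (k p), p) \<in> conn R'"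
  shows "card (P // conn R) = card (P' // conn R')"
proof (rule antisym)
  show "card (P // conn R) \<le> card (P' // conn R')"
    using assms(2,3)
  proof (rule card_quotient_le)
    fix p q assume "p \<in> P" "q \<in> P" "(h p, h q) \<in> conn R'"
    then have "(k (h p), k (h q)) \<in> conn R" using conn_image[of "h p" "h q" R' k R] k by blast
    then show "(p, q) \<in> conn R"
      using kh[OF \<open>p \<in> P\<close>] kh[OF \<open>q \<in> P\<close>] by (blast intro: conn_trans conn_sym)
  qed
  show "card (P' // conn R') \<le> card (P // conn R)"
    using assms(1,4)
  proof (rule card_quotient_le)
    fix p q assume "p \<in> P'" "q \<in> P'" "(k p, k q) \<in> conn R"
    then have "(h (k p), h (k q)) \<in> conn R'" using conn_image[of "k p" "k q" R h R'] h by blast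
    then show "(p, q) \<in> conn R'"
      using hk[OF \<open>p \<in> P'\<close>] hk[OF \<open>q \<in> P'\<close>] by (blast intro: conn_trans conn_sym)
  qed
qed

lemma conn_insert_redundant: "(a, b) \<in> conn R \<Longrightarrow> conn (insert (a, b) R) = conn R"
  by (rule conn_eqI) (auto intro: conn_incl)

text \<open>The map that collapses \<open>M\<close> and keeps all other classes is constant along
  old and new generators, so nothing beyond the classes of \<open>a\<close> and \<open>b\<close> is
  glued.\<close>

lemma conn_insert_class:
  "conn (insert (a, b) R) `` {x} =
     (let M = conn R `` {a} \<union> conn R `` {b} in if x \<in> M then M else conn R `` {x})"
proof -
  let ?M = "conn R `` {a} \<union> conn R `` {b}"
  have ab: "(a, b) \<in> conn (insert (a, b) R)" by (simp add: conn_incl)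
  have sub: "conn R \<subseteq> conn (insert (a, b) R)" by (rule conn_mono) auto
  have inM: "(p, q) \<in> conn (insert (a, b) R)" if "p \<in> ?M" "q \<in> ?M" for p q
  proof -
    let ?C = "conn (insert (a, b) R)"
    have "(a, r) \<in> ?C" if "r \<in> ?M" for r
      using that ab sub conn_trans[of a b "insert (a, b) R" r] by auto
    then show ?thesis using that conn_sym conn_trans by metis
  qed
  have M: "p \<in> ?M \<longleftrightarrow> q \<in> ?M" if "(p, q) \<in> conn (insert (a, b) R)" for p q
    using that
  proof (rule conn_invariant[where \<phi> = "\<lambda>p. p \<in> ?M"])
    fix p q assume "(p, q) \<in> insert (a, b) R"
    then consider "p = a" "q = b" | "(p, q) \<in> conn R" "(q, p) \<in> conn R"
      by (blast intro: conn_incl conn_sym)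
    then show "p \<in> ?M \<longleftrightarrow> q \<in> ?M"
      by cases (simp, blast intro: conn_trans)
  qed
  have old: "(p, q) \<in> conn R" if "(p, q) \<in> conn (insert (a, b) R)" "p \<notin> ?M" for p q
  proof -
    let ?\<phi> = "\<lambda>p. if p \<in> ?M then ?M else conn R `` {p}"
    have "?\<phi> p = ?\<phi> q"
      using that(1)
    proof (rule conn_invariant)
      fix p q assume pq: "(p, q) \<in> insert (a, b) R"
      then have "p \<in> ?M \<longleftrightarrow> q \<in> ?M" by (intro M conn_incl)
      then show "?\<phi> p = ?\<phi> q" using pq by (auto simp: conn_class_eq_iff conn_incl)
    qed
    then show ?thesis using that(2) M[OF that(1)] by (simp add: conn_class_eq_iff)
  qed
  show ?thesis
  proof (rule set_eqI)
    fix y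
    show "y \<in> conn (insert (a, b) R) `` {x} \<longleftrightarrow>
      y \<in> (let M = ?M in if x \<in> M then M else conn R `` {x})"
      using inM[of x y] M[of x y] old[of x y] sub by (auto simp: Let_def)
  qed
qed

text \<open>Only the classes of \<open>a\<close> and \<open>b\<close> are affected, so a link costs
  one class exactly when it is not already implied. Every change by one in \<open>step\<close> comes
  from here.\<close>

lemma card_quotient_conn_insert:
  assumes "finite P" "a \<in> P" "b \<in> P"
  shows "card (P // conn R) = card (P // conn (insert (a, b) R)) + (if (a, b) \<in> conn R then 0 else 1)"
proof (cases "(a, b) \<in> conn R")
  case True
  then show ?thesis by (simp add: conn_insert_redundant)
next
  case False
  define M where "M = conn R `` {a} \<union> conn R `` {b}"
  let ?N = "P // conn R - {conn R `` {a}, conn R `` {b}}"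
  have cls: "conn (insert (a, b) R) `` {x} = (if x \<in> M then M else conn R `` {x})" for x
    using conn_insert_class[of a b R x] by (simp add: M_def Let_def)
  have Mx: "x \<in> M \<longleftrightarrow> conn R `` {x} = conn R `` {a} \<or> conn R `` {x} = conn R `` {b}" for x
    unfolding conn_class_eq_iff M_def using conn_sym[of _ _ R] by blast
  have 1: "P // conn (insert (a, b) R) = insert M ?N"
  proof -
    have "a \<in> M" by (simp add: M_def)
    then show ?thesis unfolding quotient_eq_image cls using assms Mx by auto
  qed
  have "a \<in> M" "b \<in> M" by (simp_all add: M_def)
  have "M \<notin> ?N"
  proof
    assume "M \<in> ?N"
    then obtain x where "M = conn R `` {x}" "conn R `` {x} \<noteq> conn R `` {a}"
      by (auto simp: quotient_def)
    then show False using \<open>a \<in> M\<close> by (simp add: conn_class_eq_iff)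
  qed
  moreover have fin: "finite (P // conn R)" using assms(1) by (simp add: quotient_eq_image)
  moreover have "card (P // conn R) = card ?N + card {conn R `` {a}, conn R `` {b}}"
  proof -
    have "{conn R `` {a}, conn R `` {b}} \<subseteq> P // conn R"
      using assms by (auto simp: quotient_def)
    then show ?thesis using card_mono[OF fin] by (simp add: card_Diff_subset)
  qed
  moreover have "conn R `` {a} \<noteq> conn R `` {b}"
    using False by (simp add: conn_class_eq_iff)
  ultimately show ?thesis using False 1 by simp
qed


section \<open>Boundary paths between the points of an edge\<close>

definition gr :: "'a set \<Rightarrow> ('a \<Rightarrow> 'a) \<Rightarrow> ('a \<times> 'a) set" where
  "gr P f = {(x, f x) |x. x \<in> P}"

lemma gr_iff [simp]: "(a, b) \<in> gr P f \<longleftrightarrow> a \<in> P \<and> b = f a"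
  by (auto simp: gr_def)

lemma fpf_involution_onD:
  assumes "fpf_involution_on P f" "x \<in> P"
  shows "f x \<in> P" "f x \<noteq> x" "f (f x) = x"
  using assms by (auto simp: fpf_involution_on_def)

lemma path_end:
  assumes fin: "finite P" and f: "fpf_involution_on P f" and e: "e \<subseteq> P"
    and g: "fpf_involution_on (P - e) g" and x: "x \<in> e"
  defines "R \<equiv> gr P f \<union> gr (P - e) g"
  obtains z p where "z \<in> e" "z \<noteq> x" "(x, z) \<in> conn R"
    "\<And>u. u \<in> e \<Longrightarrow> (x, u) \<in> conn R \<Longrightarrow> u = x \<or> u = z" "p x" "\<not> p z"
    "\<And>a. (x, a) \<in> conn R \<Longrightarrow> p (f a) \<longleftrightarrow> \<not> p a"
    "\<And>a. (x, a) \<in> conn R \<Longrightarrow> a \<notin> e \<Longrightarrow> p (g a) \<longleftrightarrow> \<not> p a"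
proof -
  \<comment> \<open>Follow \<open>f\<close> and \<open>g\<close> alternately from \<open>x\<close> until \<open>f\<close> first leads back into \<open>e\<close>, at \<open>z\<close>.
    \<open>T\<close> holds the points left by \<open>f\<close> on the way. None of them is also entered by \<open>f\<close>: otherwise
    a segment of the path would be its own reversal, with a fixed point of \<open>f\<close> or \<open>g\<close> in its middle.\<close>
  note fD = fpf_involution_onD[OF f] and gD = fpf_involution_onD[OF g]
  define c where "c k = ((\<lambda>a. g (f a)) ^^ k) x" for k
  have c0: "c 0 = x" and cS: "c (Suc k) = g (f (c k))" for k by (simp_all add: c_def)
  have "\<exists>k. f (c k) \<in> e"
  proof (rule ccontr)
    assume "\<not> ?thesis"
    then have ne: "f (c k) \<notin> e" for k by blast
    have cP: "c k \<in> P" for k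
      by (induction k) (use x e fD gD ne in \<open>auto simp: c0 cS\<close>)
    have cSe: "c (Suc k) \<notin> e" for k
      using gD(1)[of "f (c k)"] fD(1)[OF cP[of k]] ne[of k] by (simp add: cS)
    \<comment> \<open>An equality of two iterates could be pulled back along \<open>g\<close> and
      \<open>f\<close> to index 0; but \<open>c 0 = x\<close> lies in \<open>e\<close> and no later
      iterate does.\<close>
    have "c i \<noteq> c (i + Suc d)" for i d
    proof (induction i)
      case 0
      then show ?case using cSe[of d] x by (auto simp: c0)
    next
      case (Suc i)
      show ?case
      proof
        assume "c (Suc i) = c (Suc i + Suc d)"
        then have "g (g (f (c i))) = g (g (f (c (i + Suc d))))" by (simp add: cS)
        then have "f (c i) = f (c (i + Suc d))" using gD(3) fD(1) cP ne by simp
        then have "f (f (c i)) = f (f (c (i + Suc d)))" by simp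
        then show False using Suc fD(3) cP by simp
      qed
    qed
    then have "inj c"
      by (intro linorder_injI) (metis less_iff_Suc_add add_Suc_right)
    moreover have "range c \<subseteq> P" using cP by blast
    ultimately show False using fin by (meson finite_imageD finite_subset infinite_UNIV_nat)
  qed
  define t where "t = (LEAST k. f (c k) \<in> e)"
  have t: "f (c t) \<in> e" unfolding t_def by (rule LeastI_ex) fact
  have ne: "f (c k) \<notin> e" if "k < t" for k using that not_less_Least unfolding t_def by blast
  have cP: "c k \<in> P" if "k \<le> t" for k
    using that by (induction k) (use x e fD gD ne in \<open>auto simp: c0 cS\<close>)
  have cne: "c k \<notin> e" if "0 < k" "k \<le> t" for k
    using that gD(1)[of "f (c (k - 1))"] fD(1)[OF cP[of "k - 1"]] ne[of "k - 1"]
    by (cases k) (auto simp: cS)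
  have gc: "g (c k) = f (c (k - 1))" if "0 < k" "k \<le> t" for k
    using that gD(3)[of "f (c (k - 1))"] fD(1)[OF cP[of "k - 1"]] ne[of "k - 1"]
    by (cases k) (auto simp: cS)
  define T where "T = c ` {..t}"
  have disj: "c (j + d) \<noteq> f (c j)" if "j + d \<le> t" for j d
    using that
  proof (induction d arbitrary: j rule: less_induct)
    case (less d)
    consider "d = 0" | "d = 1" | d' where "d = Suc (Suc d')" by (metis One_nat_def not0_implies_Suc)
    then show ?case
    proof cases
      case 1
      then show ?thesis using fD(2)[OF cP[of j]] less.prems by auto
    next
      case 2
      then show ?thesis
        using gD(2)[of "f (c j)"] fD(1)[OF cP[of j]] ne[of j] less.prems by (auto simp: cS)
    next
      case 3
      show ?thesis
      proof
        assume eq: "c (j + d) = f (c j)"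
        have "f (c (j + Suc d')) = g (c (j + d))" using gc[of "j + d"] less.prems 3 by simp
        also have "\<dots> = c (Suc j)" by (simp add: eq cS)
        finally have "f (f (c (j + Suc d'))) = f (c (Suc j))" by simp
        then have "c (Suc j + d') = f (c (Suc j))" using fD(3) cP less.prems 3 by simp
        then show False using less.IH[of d' "Suc j"] less.prems 3 by simp
      qed
    qed
  qed
  have fT: "f a \<notin> T" if "a \<in> T" for a
  proof -
    obtain i where i: "a = c i" "i \<le> t" using \<open>a \<in> T\<close> by (auto simp: T_def)
    have "f (c i) \<noteq> c k" if k: "k \<le> t" for k
    proof (cases "i \<le> k")
      case True
      then show ?thesis using disj[of i "k - i"] k by simp
    next
      case False
      then have "c i \<noteq> f (c k)" using disj[of k "i - k"] i by simp
      then show ?thesis using fD(3)[OF cP[OF i(2)]] by metis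
    qed
    then show ?thesis using i by (auto simp: T_def)
  qed
  \<comment> \<open>\<open>S\<close> is the path read in both directions. It is closed under
    \<open>f\<close>, and under \<open>g\<close> off \<open>e\<close>, so it contains the whole
    component of \<open>x\<close>; only its two ends lie in \<open>e\<close>.\<close>
  define S where "S = T \<union> f ` T"
  have TP: "T \<subseteq> P" using cP by (auto simp: T_def)
  have SP: "S \<subseteq> P" using TP fD(1) by (auto simp: S_def)
  have fS: "f a \<in> S \<and> (f a \<in> T \<longleftrightarrow> a \<notin> T)" if "a \<in> S" for a
    using that fT fD(3) TP by (auto simp: S_def)
  have gT: "g a \<in> f ` T" if "a \<in> T" "a \<notin> e" for a
  proof -
    obtain k where "a = c k" "k \<le> t" using \<open>a \<in> T\<close> by (auto simp: T_def)
    moreover from this have "k \<noteq> 0" using that x c0 by metis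
    ultimately have "g a = f (c (k - 1))" "c (k - 1) \<in> T" using gc by (auto simp: T_def)
    then show ?thesis by blast
  qed
  have gfT: "g (f a) \<in> T" if "a \<in> T" "f a \<notin> e" for a
  proof -
    obtain k where k: "a = c k" "k \<le> t" using \<open>a \<in> T\<close> by (auto simp: T_def)
    then have "k < t" using that t by (metis le_neq_implies_less)
    then have "c (Suc k) \<in> T" by (simp add: T_def)
    then show ?thesis using k by (simp add: cS)
  qed
  have gS: "g a \<in> S \<and> (g a \<in> T \<longleftrightarrow> a \<notin> T)" if "a \<in> S" "a \<notin> e" for a
  proof (cases "a \<in> T")
    case True
    then show ?thesis using gT[of a] fT that(2) by (auto simp: S_def)
  next
    case False
    then obtain b where "b \<in> T" "a = f b" using \<open>a \<in> S\<close> by (auto simp: S_def)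
    then show ?thesis using gfT[of b] that(2) False by (auto simp: S_def)
  qed
  have S_conn: "a \<in> S" if "(x, a) \<in> conn R" for a
  proof -
    have "x \<in> S" using c0 by (auto simp: S_def T_def)
    moreover have "x \<in> S \<longleftrightarrow> a \<in> S"
      using that
    proof (rule conn_invariant)
      fix a b assume "(a, b) \<in> R"
      then consider "a \<in> P" "b = f a" | "a \<in> P" "a \<notin> e" "b = g a" by (auto simp: R_def)
      then show "a \<in> S \<longleftrightarrow> b \<in> S"
      proof cases
        case 1
        then show ?thesis using fS[of a] fS[of b] fD(3) by auto
      next
        case 2
        then show ?thesis using gS[of a] gS[of b] gD[of a] by auto
      qed
    qed
    ultimately show ?thesis by simp
  qed
  have x_c: "(x, c k) \<in> conn R" if "k \<le> t" for k
    using that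
  proof (induction k)
    case (Suc k)
    then have "(c k, f (c k)) \<in> conn R" "(f (c k), c (Suc k)) \<in> conn R"
      using cP[of k] ne[of k] fD(1)[of "c k"] by (auto intro!: conn_incl simp: R_def cS)
    then show ?case using Suc conn_trans by (metis Suc_leD)
  qed (simp add: c0)
  \<comment> \<open>Membership in \<open>T\<close> serves as \<open>p\<close>: it records the
    direction in which the path passes a point, and is later assembled into an orientation.\<close>
  show thesis
  proof (rule that[of "f (c t)" "\<lambda>a. a \<in> T"])
    show "f (c t) \<in> e" by fact
    show "x \<in> T" using c0 by (auto simp: T_def)
    show "f (c t) \<notin> T" using fT by (auto simp: T_def)
    then show "f (c t) \<noteq> x" using \<open>x \<in> T\<close> by metis
    show "(x, f (c t)) \<in> conn R"
    proof (rule conn_trans[OF x_c[of t]])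
      show "(c t, f (c t)) \<in> conn R" using cP[of t] by (auto intro!: conn_incl simp: R_def)
    qed simp
    show "u = x \<or> u = f (c t)" if "u \<in> e" "(x, u) \<in> conn R" for u
    proof -
      have "u \<in> S" using S_conn that by blast
      then obtain k where "k \<le> t" "u = c k \<or> u = f (c k)" by (auto simp: S_def T_def)
      then show ?thesis using that(1) cne[of k] ne[of k] c0 by (cases "k = 0"; cases "k = t") auto
    qed
    show "f a \<in> T \<longleftrightarrow> a \<notin> T" if "(x, a) \<in> conn R" for a
      using fS S_conn that by blast
    show "g a \<in> T \<longleftrightarrow> a \<notin> T" if "(x, a) \<in> conn R" "a \<notin> e" for a
      using gS S_conn that by blast
  qed
qed

text \<open>Both functions flip at every generator, so whether they agree is invariant along the
  path. Hence \<open>q\<close> inherits from \<open>p\<close> that the values at the two ends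
  differ.\<close>

lemma path_end_alternating:
  assumes "(x, z) \<in> conn R" "p x" "\<not> p z"
    and "\<And>a b. (a, b) \<in> R \<Longrightarrow> (x, a) \<in> conn R \<Longrightarrow> (p b \<longleftrightarrow> \<not> p a) \<and> (q b \<longleftrightarrow> \<not> q a)"
  shows "q x \<longleftrightarrow> \<not> q z"
proof -
  have "((x, x) \<in> conn R \<and> (p x = q x)) = ((x, z) \<in> conn R \<and> (p z = q z))"
    using assms(1)
  proof (rule conn_invariant)
    fix a b assume "(a, b) \<in> R"
    then show "((x, a) \<in> conn R \<and> (p a = q a)) = ((x, b) \<in> conn R \<and> (p b = q b))"
      using assms(4)[of a b] conn_incl[of a b R] conn_sym[of a b R] conn_trans[of x _ R] by blast
  qed
  then show ?thesis using assms(1-3) by auto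
qed


section \<open>Colourings as relations on points\<close>

text \<open>A colouring is turned into a relation on points because the coloured objects change
  under deletion and contraction while the points stay. Colourings of different minors thus become
  comparable.\<close>

definition crel :: "'a set set set \<Rightarrow> ('a \<times> 'a) set" where
  "crel K = {(x, y). \<exists>c\<in>K. x \<in> \<Union>c \<and> y \<in> \<Union>c}"

lemma crel_iff: "(x, y) \<in> crel K \<longleftrightarrow> (\<exists>c\<in>K. x \<in> \<Union>c \<and> y \<in> \<Union>c)"
  by (simp add: crel_def)

lemma partition_on_block_unique:
  "partition_on P C \<Longrightarrow> v \<in> C \<Longrightarrow> w \<in> C \<Longrightarrow> x \<in> v \<Longrightarrow> x \<in> w \<Longrightarrow> v = w"
  by (auto simp: partition_on_def disjoint_def)

lemma partition_on_blockE:
  assumes "partition_on P C" "x \<in> P" obtains v where "v \<in> C" "x \<in> v"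
  using assms by (auto simp: partition_on_def)

lemma crel_subset:
  assumes "partition_on P C" "partition_on C K"
  shows "crel K \<subseteq> P \<times> P"
  using assms by (auto simp: crel_def partition_on_def)

lemma colour_class_unique:
  assumes "partition_on P C" "partition_on C K" "c \<in> K" "d \<in> K" "x \<in> \<Union>c" "x \<in> \<Union>d"
  shows "c = d"
proof -
  obtain v w where "v \<in> c" "w \<in> d" "x \<in> v" "x \<in> w" using assms(5,6) by blast
  moreover have "v \<in> C" "w \<in> C" using \<open>v \<in> c\<close> \<open>w \<in> d\<close> assms(2-4) by (auto simp: partition_on_def)
  ultimately have "v = w" using partition_on_block_unique[OF assms(1)] by blast
  then show ?thesis
    using partition_on_block_unique[OF assms(2-4)] \<open>v \<in> c\<close> \<open>w \<in> d\<close> by blast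
qed

lemma colour_class_nonempty:
  assumes "partition_on P C" "partition_on C K" "c \<in> K"
  obtains x where "x \<in> P" "x \<in> \<Union>c"
proof -
  have "c \<noteq> {}" using assms(2,3) by (auto simp: partition_on_def)
  then obtain v where v: "v \<in> c" by blast
  then have "v \<in> C" using assms(2,3) by (auto simp: partition_on_def)
  then have "v \<noteq> {}" "v \<subseteq> P" using assms(1) by (auto simp: partition_on_def)
  then show thesis using that v by blast
qed

text \<open>\<open>crel K\<close> is already symmetric and transitive, and reflexive on
  \<open>P\<close>; the closure adds only the diagonal outside \<open>P\<close>.\<close>

lemma conn_crel_iff:
  assumes "partition_on P C" "partition_on C K" "x \<in> P"
  shows "(x, y) \<in> conn (crel K) \<longleftrightarrow> (x, y) \<in> crel K"
proof
  assume "(x, y) \<in> conn (crel K)"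
  obtain v where v: "v \<in> C" "x \<in> v" using partition_on_blockE[OF assms(1,3)] .
  obtain c where c: "c \<in> K" "v \<in> c" using partition_on_blockE[OF assms(2) v(1)] .
  have "x \<in> \<Union>c \<longleftrightarrow> y \<in> \<Union>c"
    using \<open>(x, y) \<in> conn _\<close>
  proof (rule conn_invariant[where \<phi> = "\<lambda>x. x \<in> \<Union>c"])
    fix a b assume "(a, b) \<in> crel K"
    then obtain d where "d \<in> K" "a \<in> \<Union>d" "b \<in> \<Union>d" by (auto simp: crel_iff)
    then show "a \<in> \<Union>c \<longleftrightarrow> b \<in> \<Union>c"
      using colour_class_unique[OF assms(1,2) c(1) \<open>d \<in> K\<close>] by blast
  qed
  then show "(x, y) \<in> crel K" using c v by (auto simp: crel_iff)
qed (rule conn_incl)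

lemma conn_crel_class:
  assumes "partition_on P C" "partition_on C K" "c \<in> K" "x \<in> \<Union>c" "x \<in> P"
  shows "conn (crel K) `` {x} = \<Union>c"
proof (rule set_eqI)
  fix y
  have "(x, y) \<in> crel K \<longleftrightarrow> y \<in> \<Union>c"
    using colour_class_unique[OF assms(1,2)] assms(3,4) unfolding crel_iff by metis
  then show "y \<in> conn (crel K) `` {x} \<longleftrightarrow> y \<in> \<Union>c"
    using conn_crel_iff[OF assms(1,2,5)] by simp
qed

lemma card_colouring:
  assumes "partition_on P C" "partition_on C K"
  shows "card (P // conn (crel K)) = card K"
proof -
  have "P // conn (crel K) = Union ` K"
  proof (intro equalityI subsetI)
    fix B assume "B \<in> P // conn (crel K)"
    then obtain x where x: "x \<in> P" "B = conn (crel K) `` {x}" by (auto simp: quotient_def)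
    obtain v where v: "v \<in> C" "x \<in> v" using partition_on_blockE[OF assms(1) x(1)] .
    obtain c where c: "c \<in> K" "v \<in> c" using partition_on_blockE[OF assms(2) v(1)] .
    have "B = \<Union>c" using conn_crel_class[OF assms c(1) _ x(1)] v c x(2) by blast
    then show "B \<in> Union ` K" using c by blast
  next
    fix B assume "B \<in> Union ` K"
    then obtain c where c: "c \<in> K" "B = \<Union>c" by blast
    obtain x where x: "x \<in> P" "x \<in> \<Union>c" using colour_class_nonempty[OF assms c(1)] .
    have "B = conn (crel K) `` {x}" using conn_crel_class[OF assms c(1) x(2,1)] c by simp
    then show "B \<in> P // conn (crel K)" using x(1) by (auto simp: quotient_def)
  qed
  moreover have "inj_on Union K"
  proof (rule inj_onI)
    fix c d assume cd: "c \<in> K" "d \<in> K" "\<Union>c = \<Union>d"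
    obtain x where "x \<in> \<Union>c" using colour_class_nonempty[OF assms cd(1)] .
    then show "c = d" using colour_class_unique[OF assms cd(1,2)] cd(3) by simp
  qed
  ultimately show ?thesis by (simp add: card_image)
qed

section \<open>Recolouring as a change of generators\<close>

context
  fixes P :: "'a set" and C S :: "'a set set" and K :: "'a set set set" and e :: "'a set"
  assumes C: "partition_on P C" and S: "partition_on P S" and K: "partition_on C K"
    and same: "{v \<in> C. v \<inter> e = {}} = {v \<in> S. v \<inter> e = {}}"
    and e: "e \<noteq> {}" "e \<subseteq> P"
begin

private definition "M = {v \<in> \<Union>{c \<in> K. \<exists>w\<in>c. w \<inter> e \<noteq> {}}. v \<inter> e = {}} \<union> {v \<in> S. v \<inter> e \<noteq> {}}"

private lemma recolour_M: "recolour e S K = insert M {c \<in> K. \<forall>v\<in>c. v \<inter> e = {}}"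
  by (auto simp: recolour_def M_def)

private lemma K_sub: "c \<in> K \<Longrightarrow> v \<in> c \<Longrightarrow> v \<in> C"
  using K by (auto simp: partition_on_def)

private lemma same_iff: "v \<inter> e = {} \<Longrightarrow> v \<in> C \<longleftrightarrow> v \<in> S"
  using same by blast

text \<open>Old and new objects that avoid \<open>e\<close> agree, so the old objects meeting
  \<open>e\<close> and the new objects meeting \<open>e\<close> cover the same points, namely the
  complement of the common part.\<close>

private lemma Union_M: "x \<in> \<Union>M \<longleftrightarrow> (\<exists>c\<in>K. (\<exists>w\<in>c. w \<inter> e \<noteq> {}) \<and> x \<in> \<Union>c)"
proof
  assume "x \<in> \<Union>M"
  then obtain v where v: "v \<in> M" "x \<in> v" by blast
  show "\<exists>c\<in>K. (\<exists>w\<in>c. w \<inter> e \<noteq> {}) \<and> x \<in> \<Union>c"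
  proof (cases "v \<inter> e = {}")
    case True
    then show ?thesis using v by (auto simp: M_def)
  next
    case False
    then have "v \<in> S" using v by (auto simp: M_def)
    then have "x \<in> P" using S v(2) by (auto simp: partition_on_def)
    obtain w where w: "w \<in> C" "x \<in> w" using partition_on_blockE[OF C \<open>x \<in> P\<close>] .
    obtain c where c: "c \<in> K" "w \<in> c" using partition_on_blockE[OF K w(1)] .
    have "w \<inter> e \<noteq> {}"
      using same_iff[of w] w False partition_on_block_unique[OF S, of v w x] \<open>v \<in> S\<close> v(2) by blast
    then show ?thesis using w c by blast
  qed
next
  assume "\<exists>c\<in>K. (\<exists>w\<in>c. w \<inter> e \<noteq> {}) \<and> x \<in> \<Union>c"
  then obtain c w where c: "c \<in> K" "\<exists>w\<in>c. w \<inter> e \<noteq> {}" and w: "w \<in> c" "x \<in> w" by blast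
  show "x \<in> \<Union>M"
  proof (cases "w \<inter> e = {}")
    case True
    then have "w \<in> M" using c w unfolding M_def by blast
    then show ?thesis using w by blast
  next
    case False
    have "w \<in> C" using K_sub c w by blast
    then have "x \<in> P" using C w(2) by (auto simp: partition_on_def)
    obtain v where v: "v \<in> S" "x \<in> v" using partition_on_blockE[OF S \<open>x \<in> P\<close>] .
    have "v \<inter> e \<noteq> {}"
      using same_iff[of v] v False partition_on_block_unique[OF C, of v w x] \<open>w \<in> C\<close> w(2) by blast
    then show ?thesis using v by (auto simp: M_def)
  qed
qed

lemma partition_on_recolour: "partition_on S (recolour e S K)"
proof (rule partition_onI)
  show "\<Union>(recolour e S K) = S"
  proof (intro equalityI subsetI)
    fix v assume "v \<in> \<Union>(recolour e S K)"
    then consider "v \<in> S" | c where "c \<in> K" "v \<in> c" "v \<inter> e = {}"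
      unfolding recolour_M M_def by blast
    then show "v \<in> S" using same_iff K_sub by cases blast+
  next
    fix v assume "v \<in> S"
    show "v \<in> \<Union>(recolour e S K)"
    proof (cases "v \<inter> e = {}")
      case True
      then have "v \<in> C" using same_iff \<open>v \<in> S\<close> by blast
      obtain c where "c \<in> K" "v \<in> c" using partition_on_blockE[OF K \<open>v \<in> C\<close>] .
      then have "c = {v \<in> c. v \<inter> e = {}} \<or> v \<in> M" using True unfolding M_def by blast
      then have "c \<in> recolour e S K \<or> v \<in> M" using \<open>c \<in> K\<close> unfolding recolour_M by blast
      then show ?thesis using \<open>v \<in> c\<close> unfolding recolour_M by blast
    qed (use \<open>v \<in> S\<close> in \<open>auto simp: recolour_M M_def\<close>)
  qed
  obtain x where "x \<in> e" using e by blast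
  obtain v where "v \<in> S" "x \<in> v" using partition_on_blockE[OF S] \<open>x \<in> e\<close> e by blast
  then have "M \<noteq> {}" using \<open>x \<in> e\<close> by (auto simp: M_def)
  then show "{} \<notin> recolour e S K" using K by (auto simp: recolour_M partition_on_def)
  have dj: "disjnt c M" if "c \<in> K" "\<forall>v\<in>c. v \<inter> e = {}" for c
    using partition_on_block_unique[OF K that(1)] that(2) by (auto simp: M_def disjnt_iff)
  show "disjnt c d" if "c \<in> recolour e S K" "d \<in> recolour e S K" "c \<noteq> d" for c d
  proof -
    have "disjnt c d" if "c \<in> K" "d \<in> K"
      using partition_on_block_unique[OF K that] \<open>c \<noteq> d\<close> by (auto simp: disjnt_iff)
    then show ?thesis using that dj dj[THEN disjnt_sym] unfolding recolour_M by blast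
  qed
qed

text \<open>The merged class contains all points of \<open>e\<close>, and a class without objects
  meeting \<open>e\<close> is kept. The new objects \<open>S\<close> drop out of the result, so
  recolourings at several edges compose without following the objects.\<close>

lemma conn_crel_recolour: "conn (crel (recolour e S K)) = conn (crel K \<union> e \<times> e)"
proof (rule conn_eqI)
  fix a b assume "(a, b) \<in> crel (recolour e S K)"
  then consider c where "c \<in> K" "a \<in> \<Union>c" "b \<in> \<Union>c" | "a \<in> \<Union>M" "b \<in> \<Union>M"
    unfolding crel_iff recolour_M by blast
  then show "(a, b) \<in> conn (crel K \<union> e \<times> e)"
  proof cases
    case 1
    then show ?thesis by (intro conn_incl) (auto simp: crel_iff)
  next
    case 2
    have "\<exists>p\<in>e. (a, p) \<in> crel K" if "a \<in> \<Union>M" for a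
      using that unfolding Union_M crel_iff by blast
    then obtain p q where "p \<in> e" "(a, p) \<in> crel K" "q \<in> e" "(b, q) \<in> crel K"
      using 2 by blast
    then have "(a, p) \<in> conn (crel K \<union> e \<times> e)" "(p, q) \<in> conn (crel K \<union> e \<times> e)"
      "(b, q) \<in> conn (crel K \<union> e \<times> e)"
      by (auto intro: conn_incl)
    then show ?thesis by (metis conn_sym conn_trans)
  qed
next
  fix a b assume "(a, b) \<in> crel K \<union> e \<times> e"
  then consider "(a, b) \<in> crel K" | "a \<in> e" "b \<in> e" by blast
  then show "(a, b) \<in> conn (crel (recolour e S K))"
  proof cases
    case 1
    then obtain c where c: "c \<in> K" "a \<in> \<Union>c" "b \<in> \<Union>c" by (auto simp: crel_iff)
    then have "(\<forall>v\<in>c. v \<inter> e = {}) \<or> a \<in> \<Union>M \<and> b \<in> \<Union>M" unfolding Union_M by blast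
    then show ?thesis using c by (intro conn_incl) (auto simp: crel_iff recolour_M)
  next
    case 2
    have "a \<in> \<Union>M" if "a \<in> e" for a
    proof -
      obtain v where "v \<in> S" "a \<in> v" using partition_on_blockE[OF S] \<open>a \<in> e\<close> e by blast
      then show ?thesis using that by (auto simp: M_def)
    qed
    then show ?thesis using 2 by (intro conn_incl) (auto simp: crel_iff recolour_M)
  qed
qed

end

section \<open>Edges, deletion and contraction\<close>

text \<open>For involutions the generators are symmetric, so the one-way closure in
  \<open>curves\<close> is already an equivalence.\<close>

lemma curves_eq_quotient:
  assumes "fpf_involution_on P f" "fpf_involution_on P g"
  shows "curves P f g = P // conn (gr P f \<union> gr P g)"
proof -
  have "(gr P f \<union> gr P g)\<inverse> \<subseteq> gr P f \<union> gr P g"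
    using assms by (auto simp: fpf_involution_onD)
  then have "conn (gr P f \<union> gr P g) = (gr P f \<union> gr P g)\<^sup>*"
    by (simp add: conn_def Un_absorb2)
  then show ?thesis by (simp add: curves_def gr_def)
qed

lemma gr_Un_subset:
  assumes "fpf_involution_on P f" "fpf_involution_on P g"
  shows "gr P f \<union> gr P g \<subseteq> P \<times> P"
  using assms by (auto simp: fpf_involution_onD)

lemma partition_on_curves:
  assumes "fpf_involution_on P f" "fpf_involution_on P g"
  shows "partition_on P (curves P f g)"
  unfolding curves_eq_quotient[OF assms] by (intro partition_on_quotient_conn gr_Un_subset assms)

text \<open>A curve that avoids \<open>e\<close> never passes a point at which \<open>g\<close> and
  \<open>g'\<close> differ.\<close>

lemma curves_avoiding_subset:
  assumes f: "fpf_involution_on P f" and g: "fpf_involution_on P g" and g': "fpf_involution_on P g'"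
    and eq: "\<And>x. x \<in> P \<Longrightarrow> x \<notin> e \<Longrightarrow> g x = g' x"
  shows "{v \<in> curves P f g. v \<inter> e = {}} \<subseteq> {v \<in> curves P f g'. v \<inter> e = {}}"
proof clarify
  fix v assume v: "v \<in> curves P f g" "v \<inter> e = {}"
  let ?R = "gr P f \<union> gr P g" and ?R' = "gr P f \<union> gr P g'"
  obtain x where x: "x \<in> P" "v = conn ?R `` {x}"
    using v(1) unfolding curves_eq_quotient[OF f g] by (auto simp: quotient_def)
  have ne: "a \<notin> e" if "(x, a) \<in> conn ?R" for a using that v(2) x(2) by blast
  have "conn ?R `` {x} = conn ?R' `` {x}"
  proof (intro equalityI subsetI)
    fix y assume "y \<in> conn ?R `` {x}"
    then have "(x, y) \<in> conn ?R" by blast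
    then have "((x, x) \<in> conn ?R \<and> (x, x) \<in> conn ?R') = ((x, y) \<in> conn ?R \<and> (x, y) \<in> conn ?R')"
    proof (rule conn_invariant)
      fix a b assume ab: "(a, b) \<in> ?R"
      have "(a, b) \<in> ?R'" if "(x, a) \<in> conn ?R" using ab ne[OF that] eq[of a] by auto
      moreover have "(x, a) \<in> conn ?R \<longleftrightarrow> (x, b) \<in> conn ?R"
        using conn_incl[OF ab] conn_sym conn_trans by metis
      ultimately show "((x, a) \<in> conn ?R \<and> (x, a) \<in> conn ?R') = ((x, b) \<in> conn ?R \<and> (x, b) \<in> conn ?R')"
        using conn_incl[of a b ?R'] conn_sym conn_trans by metis
    qed
    then show "y \<in> conn ?R' `` {x}" using \<open>(x, y) \<in> conn ?R\<close> by auto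
  next
    fix y assume "y \<in> conn ?R' `` {x}"
    then have "(x, y) \<in> conn ?R'" by blast
    then have "((x, x) \<in> conn ?R) = ((x, y) \<in> conn ?R)"
    proof (rule conn_invariant)
      fix a b assume ab: "(a, b) \<in> ?R'"
      show "(x, a) \<in> conn ?R \<longleftrightarrow> (x, b) \<in> conn ?R"
      proof (cases "(x, a) \<in> conn ?R \<or> (x, b) \<in> conn ?R")
        case True
        have "(a, b) \<in> ?R \<or> (b, a) \<in> ?R"
        proof (cases "(x, a) \<in> conn ?R")
          case True
          then show ?thesis using ab ne[OF True] eq[of a] by auto
        next
          case False
          \<comment> \<open>Here the generator is met at its far end: \<open>b\<close> is on the
            curve, hence outside \<open>e\<close>, and the involution leads from \<open>b\<close>
            back to \<open>a\<close>.\<close>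
          then have "b \<notin> e" using ne True by blast
          then show ?thesis
            using ab eq[of b] fpf_involution_onD[OF f] fpf_involution_onD[OF g'] by auto
        qed
        then have "(a, b) \<in> conn ?R" using conn_incl conn_sym by metis
        then show ?thesis using conn_sym conn_trans by metis
      qed blast
    qed
    then show "y \<in> conn ?R `` {x}" by simp
  qed
  then show "v \<in> curves P f g'"
    using x unfolding curves_eq_quotient[OF f g'] by (auto simp: quotient_def)
qed

lemma curves_avoiding:
  assumes "fpf_involution_on P f" "fpf_involution_on P g" "fpf_involution_on P g'"
    and "\<And>x. x \<in> P \<Longrightarrow> x \<notin> e \<Longrightarrow> g x = g' x"
  shows "{v \<in> curves P f g. v \<inter> e = {}} = {v \<in> curves P f g'. v \<inter> e = {}}"
  using curves_avoiding_subset[OF assms(1,2,3)] curves_avoiding_subset[OF assms(1,3,2)] assms(4)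
  by (metis (no_types, lifting) subset_antisym)


lemma ribbon_graphD:
  assumes "ribbon_graph G"
  shows "finite (pts G)" "fpf_involution_on (pts G) (arc G)" "fpf_involution_on (pts G) (seg G)"
    "fpf_involution_on (pts G) (side G)" "\<And>x. x \<in> pts G \<Longrightarrow> seg G (side G x) = side G (seg G x)"
  using assms by (auto simp: ribbon_graph_def)

lemma coloured_ribbon_graphD:
  assumes "coloured_ribbon_graph G"
  shows "ribbon_graph G" "partition_on (verts G) (vcol G)" "partition_on (bounds G) (bcol G)"
    "partition_on (pts G) (verts G)" "partition_on (pts G) (bounds G)"
  using assms ribbon_graphD[of G]
  by (auto simp: coloured_ribbon_graph_def verts_def bounds_def intro: partition_on_curves)

context
  fixes G :: "('a, 'z) ribbon_scheme" and e :: "'a set"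
  assumes G: "ribbon_graph G" and e: "e \<in> edges G"
begin

lemma edge_subset: "e \<subseteq> pts G"
  using e ribbon_graphD[OF G] by (auto simp: edges_def fpf_involution_onD)

lemma edge_nonempty: "e \<noteq> {}"
  using e by (auto simp: edges_def)

lemma edge_eq:
  assumes "x \<in> e"
  shows "e = {x, seg G x, side G x, seg G (side G x)}" "seg G x \<noteq> side G x"
proof -
  note [simp] = fpf_involution_onD[OF ribbon_graphD(3)[OF G]]
    fpf_involution_onD[OF ribbon_graphD(4)[OF G]] ribbon_graphD(5)[OF G]
  obtain y where y: "y \<in> pts G" "seg G y \<noteq> side G y" "e = {y, seg G y, side G y, seg G (side G y)}"
    using e by (auto simp: edges_def)
  have "e = {x, seg G x, side G x, seg G (side G x)} \<and> seg G x \<noteq> side G x"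
  proof -
    consider "x = y" | "x = seg G y" | "x = side G y" | "x = seg G (side G y)"
      using assms y(3) by blast
    moreover have "side G (seg G y) \<noteq> y"
    proof
      assume "side G (seg G y) = y"
      then have "side G (side G (seg G y)) = side G y" by simp
      then show False using y(1,2) by simp
    qed
    ultimately show ?thesis
      by cases (use y in \<open>auto simp: insert_commute\<close>)
  qed
  then show "e = {x, seg G x, side G x, seg G (side G x)}" "seg G x \<noteq> side G x" by auto
qed

lemma edge_closed: "x \<in> e \<Longrightarrow> seg G x \<in> e" "x \<in> e \<Longrightarrow> side G x \<in> e"
  using edge_eq(1) by blast+

lemma edge_closed_iff:
  assumes "x \<in> pts G"
  shows "seg G x \<in> e \<longleftrightarrow> x \<in> e" "side G x \<in> e \<longleftrightarrow> x \<in> e"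
  using assms edge_closed fpf_involution_onD(3)[OF ribbon_graphD(3)[OF G]]
    fpf_involution_onD(3)[OF ribbon_graphD(4)[OF G]] by metis+

end

lemma edges_disjoint:
  assumes "ribbon_graph G" "e \<in> edges G" "e' \<in> edges G" "x \<in> e" "x \<in> e'"
  shows "e = e'"
  using edge_eq(1)[OF assms(1,2,4)] edge_eq(1)[OF assms(1,3,5)] by simp

lemma in_Union_edges_iff:
  assumes "ribbon_graph G" "x \<in> pts G"
  shows "x \<in> \<Union>(edges G) \<longleftrightarrow> seg G x \<noteq> side G x"
  using assms edge_eq(2)[OF assms(1)] by (auto simp: edges_def)

lemma finite_edges: "ribbon_graph G \<Longrightarrow> finite (edges G)"
  using edge_subset[of G] ribbon_graphD(1)[of G] by (meson Pow_iff finite_Pow_iff finite_subset subsetI)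

text \<open>This is the geometric dual. Exchanging \<open>seg\<close> and \<open>side\<close> swaps
  vertices with boundary components, their colourings, and contraction with deletion, so facts about
  deletion follow from those about contraction.\<close>

definition dual :: "'a coloured_ribbon \<Rightarrow> 'a coloured_ribbon" where
  "dual G = \<lparr>pts = pts G, arc = arc G, seg = side G, side = seg G, vcol = bcol G, bcol = vcol G\<rparr>"

lemma dual_simps [simp]:
  "pts (dual G) = pts G" "arc (dual G) = arc G" "seg (dual G) = side G" "side (dual G) = seg G"
  "vcol (dual G) = bcol G" "bcol (dual G) = vcol G" "verts (dual G) = bounds G"
  "bounds (dual G) = verts G" "dual (dual G) = G"
  by (simp_all add: dual_def verts_def bounds_def)

lemma ribbon_graph_dual [simp]: "ribbon_graph (dual G) \<longleftrightarrow> ribbon_graph G"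
  by (auto simp: ribbon_graph_def)

lemma coloured_ribbon_graph_dual [simp]: "coloured_ribbon_graph (dual G) \<longleftrightarrow> coloured_ribbon_graph G"
  by (auto simp: coloured_ribbon_graph_def)

lemma edges_dual:
  assumes "ribbon_graph G"
  shows "edges (dual G) = edges G"
proof -
  have "{x, side G x, seg G x, side G (seg G x)} = {x, seg G x, side G x, seg G (side G x)}"
    if "x \<in> pts G" for x
    using ribbon_graphD(5)[OF assms that] by auto
  then show ?thesis unfolding edges_def by (auto 4 4 simp: eq_commute)
qed

lemma delete_eq_dual: "delete e G = dual (contract e (dual G))"
  by (cases G) (simp add: delete_def contract_def Let_def dual_def verts_def bounds_def cong: if_cong)

lemma contract_simps:
  "pts (contract e G) = pts G" "arc (contract e G) = arc G"
  "seg (contract e G) = (\<lambda>x. if x \<in> e then side G x else seg G x)"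
  "side (contract e G) = side G" "bcol (contract e G) = bcol G" "bounds (contract e G) = bounds G"
  "vcol (contract e G) = recolour e (verts (contract e G)) (vcol G)"
  by (simp_all add: contract_def Let_def verts_def bounds_def)

lemma delete_simps:
  "pts (delete e G) = pts G" "arc (delete e G) = arc G"
  "side (delete e G) = (\<lambda>x. if x \<in> e then seg G x else side G x)"
  "seg (delete e G) = seg G" "vcol (delete e G) = vcol G" "verts (delete e G) = verts G"
  by (simp_all add: delete_eq_dual contract_simps cong: if_cong)

context
  fixes G :: "'a coloured_ribbon" and e :: "'a set"
  assumes G: "coloured_ribbon_graph G" and e: "e \<in> edges G"
begin

private lemma rG: "ribbon_graph G"
  using G by (rule coloured_ribbon_graphD)

lemma ribbon_graph_contract: "ribbon_graph (contract e G)"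
  using ribbon_graphD[OF rG] edge_closed[OF rG e] edge_closed_iff[OF rG e]
  by (auto simp: ribbon_graph_def contract_simps fpf_involution_on_def)

private lemma verts_contract_avoiding:
  "{v \<in> verts G. v \<inter> e = {}} = {v \<in> verts (contract e G). v \<inter> e = {}}"
  unfolding verts_def
  using ribbon_graphD[OF rG] ribbon_graphD[OF ribbon_graph_contract]
  unfolding contract_simps by (intro curves_avoiding) auto

private lemmas recolour_facts =
  coloured_ribbon_graphD(4)[OF G]
  partition_on_curves[OF ribbon_graphD(2,3)[OF ribbon_graph_contract], folded verts_def,
    unfolded contract_simps(1)]
  coloured_ribbon_graphD(2)[OF G] verts_contract_avoiding
  edge_nonempty[OF rG e] edge_subset[OF rG e]

lemma coloured_ribbon_graph_contract: "coloured_ribbon_graph (contract e G)"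
  using ribbon_graph_contract coloured_ribbon_graphD(3)[OF G] partition_on_recolour[OF recolour_facts]
  by (simp add: coloured_ribbon_graph_def contract_simps)

lemma conn_crel_vcol_contract: "conn (crel (vcol (contract e G))) = conn (crel (vcol G) \<union> e \<times> e)"
  using conn_crel_recolour[OF recolour_facts] by (simp add: contract_simps)

lemma edges_contract: "edges (contract e G) = edges G - {e}"
proof -
  have "edges (contract e G) = {{x, seg G x, side G x, seg G (side G x)} |x.
      x \<in> pts G \<and> x \<notin> e \<and> seg G x \<noteq> side G x}"
    unfolding edges_def contract_simps using edge_closed_iff[OF rG e] by (auto split: if_splits)
  also have "\<dots> = edges G - {e}"
  proof -
    have "{x, seg G x, side G x, seg G (side G x)} \<noteq> e" if "x \<notin> e" for x using that by blast
    moreover have "x \<notin> e" if "{x, seg G x, side G x, seg G (side G x)} \<noteq> e" for x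
      using that edge_eq(1)[OF rG e, of x] by auto
    ultimately show ?thesis unfolding edges_def by blast
  qed
  finally show ?thesis .
qed

end

lemma
  assumes G: "coloured_ribbon_graph G" and e: "e \<in> edges G"
  shows coloured_ribbon_graph_delete: "coloured_ribbon_graph (delete e G)"
    and conn_crel_bcol_delete: "conn (crel (bcol (delete e G))) = conn (crel (bcol G) \<union> e \<times> e)"
    and edges_delete: "edges (delete e G) = edges G - {e}"
proof -
  have *: "coloured_ribbon_graph (dual G)" "e \<in> edges (dual G)"
    using assms edges_dual[OF coloured_ribbon_graphD(1)[OF G]] by auto
  show "coloured_ribbon_graph (delete e G)"
    using coloured_ribbon_graph_contract[OF *] by (simp add: delete_eq_dual)
  show "conn (crel (bcol (delete e G))) = conn (crel (bcol G) \<union> e \<times> e)"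
    using conn_crel_vcol_contract[OF *] by (simp add: delete_eq_dual)
  show "edges (delete e G) = edges G - {e}"
    using edges_contract[OF *] ribbon_graph_contract[OF *] coloured_ribbon_graphD(1)[OF G]
    by (simp add: delete_eq_dual edges_dual)
qed

section \<open>Counting vertices and colour classes of minors\<close>

text \<open>
  The numbers of vertices, vertex colour classes and boundary colour classes of the edgeless graph
  obtained from \<open>G\<close> by contracting the edges in \<open>A\<close> and deleting all others.
\<close>

definition clq :: "'a set set \<Rightarrow> ('a \<times> 'a) set" where
  "clq A = (\<Union>e\<in>A. e \<times> e)"

definition vnum :: "'a coloured_ribbon \<Rightarrow> 'a set set \<Rightarrow> nat" where
  "vnum G A = card (pts G // conn (gr (pts G) (arc G) \<union>
     gr (pts G) (\<lambda>x. if x \<in> \<Union>A then side G x else seg G x)))"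

definition vcnum :: "'a coloured_ribbon \<Rightarrow> 'a set set \<Rightarrow> nat" where
  "vcnum G A = card (pts G // conn (crel (vcol G) \<union> clq A))"

definition bcnum :: "'a coloured_ribbon \<Rightarrow> 'a set set \<Rightarrow> nat" where
  "bcnum G A = card (pts G // conn (crel (bcol G) \<union> clq (edges G - A)))"

lemma clq_insert: "clq (insert e A) = e \<times> e \<union> clq A"
  by (simp add: clq_def)

lemma conn_Un_cong: "conn R = conn S \<Longrightarrow> conn (R \<union> Q) = conn (S \<union> Q)"
  by (metis conn_conn_Un)

text \<open>In the vertex relation, contracting \<open>e\<close> exchanges its segments for its
  sides; in the vertex colours it links the points of \<open>e\<close>. Membership of
  \<open>e\<close> in the set of contracted edges has the same two effects. For boundary colours,
  \<open>e\<close> is not among the deleted edges on either side.\<close>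

lemma
  assumes G: "coloured_ribbon_graph G" and e: "e \<in> edges G"
  shows vnum_contract: "vnum (contract e G) A = vnum G (insert e A)"
    and vcnum_contract: "vcnum (contract e G) A = vcnum G (insert e A)"
    and bcnum_contract: "bcnum (contract e G) A = bcnum G (insert e A)"
proof -
  have "(\<lambda>x. if x \<in> \<Union>A then side G x else if x \<in> e then side G x else seg G x) =
      (\<lambda>x. if x \<in> \<Union>(insert e A) then side G x else seg G x)" by auto
  then show "vnum (contract e G) A = vnum G (insert e A)"
    unfolding vnum_def contract_simps by (rule arg_cong)
  show "vcnum (contract e G) A = vcnum G (insert e A)"
    using conn_Un_cong[OF conn_crel_vcol_contract[OF assms], of "clq A"]
    unfolding vcnum_def clq_insert contract_simps(1) by (simp only: Un_assoc)
  show "bcnum (contract e G) A = bcnum G (insert e A)"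
    unfolding bcnum_def contract_simps edges_contract[OF assms] by (simp only: Diff_insert2[of "edges G" e A])
qed

text \<open>Seen from a set \<open>A\<close> without \<open>e\<close>, the points of
  \<open>e\<close> follow \<open>seg\<close> in both graphs. The link \<open>e \<times> e\<close>
  that deletion puts into the boundary colours is, in \<open>G\<close>, the contribution of
  \<open>e\<close> as an edge outside \<open>A\<close>.\<close>

lemma
  assumes G: "coloured_ribbon_graph G" and e: "e \<in> edges G" and A: "A \<subseteq> edges G - {e}"
  shows vnum_delete: "vnum (delete e G) A = vnum G A"
    and vcnum_delete: "vcnum (delete e G) A = vcnum G A"
    and bcnum_delete: "bcnum (delete e G) A = bcnum G A"
proof -
  have "x \<notin> e" if "x \<in> \<Union>A" for x
    using that A edges_disjoint[OF coloured_ribbon_graphD(1)[OF G] e, of _ x] by blast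
  then have "(\<lambda>x. if x \<in> \<Union>A then if x \<in> e then seg G x else side G x else seg G x) =
      (\<lambda>x. if x \<in> \<Union>A then side G x else seg G x)" by auto
  then show "vnum (delete e G) A = vnum G A"
    unfolding vnum_def delete_simps by (rule arg_cong)
  show "vcnum (delete e G) A = vcnum G A"
    unfolding vcnum_def delete_simps ..
  have "clq (edges G - A) = e \<times> e \<union> clq (edges G - {e} - A)"
    using e A unfolding clq_insert[symmetric] by (intro arg_cong[where f = clq]) blast
  then show "bcnum (delete e G) A = bcnum G A"
    using conn_Un_cong[OF conn_crel_bcol_delete[OF G e], of "clq (edges G - {e} - A)"]
    unfolding bcnum_def edges_delete[OF G e] delete_simps(1) by (simp only: Un_assoc)
qed

lemma
  assumes "coloured_ribbon_graph G"
  shows vnum_empty: "vnum G {} = card (verts G)"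
    and vcnum_empty: "vcnum G {} = card (vcol G)"
    and bcnum_edges: "bcnum G (edges G) = card (bcol G)"
  using coloured_ribbon_graphD[OF assms] ribbon_graphD[OF coloured_ribbon_graphD(1)[OF assms]]
  by (simp_all add: vnum_def vcnum_def bcnum_def clq_def card_colouring verts_def
      curves_eq_quotient[symmetric])


section \<open>Ribbon graphs with one edge\<close>

text \<open>
  The first triple counts vertices, vertex colour classes and boundary colour classes after deleting
  the last remaining edge, the second after contracting it; the type is that of the last edge.
\<close>

fun step :: "edge_type \<Rightarrow> nat \<times> nat \<times> nat \<Rightarrow> nat \<times> nat \<times> nat \<Rightarrow> bool" where
  "step bs (v, n, m) (v', n', m') \<longleftrightarrow> v = v' + 1 \<and> n = n' + 1 \<and> m' = m"
| "step bp (v, n, m) (v', n', m') \<longleftrightarrow> v = v' + 1 \<and> n = n' \<and> m' = m"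
| "step olc (v, n, m) (v', n', m') \<longleftrightarrow> v' = v + 1 \<and> n = n' \<and> m' = m + 1"
| "step olh (v, n, m) (v', n', m') \<longleftrightarrow> v' = v + 1 \<and> n = n' \<and> m' = m"
| "step nl (v, n, m) (v', n', m') \<longleftrightarrow> v' = v \<and> n = n' \<and> m' = m"

definition state :: "'a coloured_ribbon \<Rightarrow> 'a set set \<Rightarrow> nat \<times> nat \<times> nat" where
  "state G A = (vnum G A, vcnum G A, bcnum G A)"

text \<open>A curve never leaves a set closed under both involutions. This identifies the vertices
  and boundary components that survive \<open>remove_isolated\<close>.\<close>

lemma curves_restrict:
  assumes f: "fpf_involution_on P f" and g: "fpf_involution_on P g" and W: "W \<subseteq> P"
    and fW: "\<And>a. a \<in> W \<Longrightarrow> f a \<in> W" and gW: "\<And>a. a \<in> W \<Longrightarrow> g a \<in> W"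
  shows "curves W f g = {v \<in> curves P f g. v \<subseteq> W}"
proof -
  let ?R = "gr P f \<union> gr P g" and ?R' = "gr W f \<union> gr W g"
  have f': "fpf_involution_on W f" and g': "fpf_involution_on W g"
    using f g W fW gW by (auto simp: fpf_involution_on_def)
  have W_iff: "a \<in> W \<longleftrightarrow> b \<in> W" if "(a, b) \<in> ?R" for a b
    using that fW[of a] gW[of a] fW[of b] gW[of b] fpf_involution_onD(3)[OF f]
      fpf_involution_onD(3)[OF g] by auto
  have W_conn: "a \<in> W \<longleftrightarrow> b \<in> W" if "(a, b) \<in> conn ?R" for a b
    using that W_iff by (rule conn_invariant)
  have sub: "conn ?R' \<subseteq> conn ?R" using W by (intro conn_mono) auto
  have "conn ?R' `` {a} = conn ?R `` {a}" if "a \<in> W" for a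
  proof (intro equalityI subsetI)
    fix b assume "b \<in> conn ?R `` {a}"
    then have ab: "(a, b) \<in> conn ?R" by blast
    then have "(a \<in> W \<and> (a, a) \<in> conn ?R') = (b \<in> W \<and> (a, b) \<in> conn ?R')"
    proof (rule conn_invariant)
      fix p q assume pq: "(p, q) \<in> ?R"
      have "(p, q) \<in> ?R'" if "p \<in> W" using pq that by auto
      then show "(p \<in> W \<and> (a, p) \<in> conn ?R') = (q \<in> W \<and> (a, q) \<in> conn ?R')"
        using W_iff[OF pq] conn_incl[of p q ?R'] conn_sym conn_trans by metis
    qed
    then show "b \<in> conn ?R' `` {a}" using that by simp
  qed (use sub in blast)
  then have "curves W f g = (\<lambda>a. conn ?R `` {a}) ` W"
    by (simp add: curves_eq_quotient[OF f' g'] quotient_eq_image)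
  also have "\<dots> = {v \<in> (\<lambda>a. conn ?R `` {a}) ` P. v \<subseteq> W}"
  proof (intro equalityI subsetI)
    fix v assume "v \<in> (\<lambda>a. conn ?R `` {a}) ` W"
    then show "v \<in> {v \<in> (\<lambda>a. conn ?R `` {a}) ` P. v \<subseteq> W}" using W W_conn by auto
  next
    fix v assume "v \<in> {v \<in> (\<lambda>a. conn ?R `` {a}) ` P. v \<subseteq> W}"
    then obtain a where "v = conn ?R `` {a}" "conn ?R `` {a} \<subseteq> W" by blast
    moreover have "a \<in> conn ?R `` {a}" by simp
    ultimately show "v \<in> (\<lambda>a. conn ?R `` {a}) ` W" by blast
  qed
  finally show ?thesis by (simp add: curves_eq_quotient[OF f g] quotient_eq_image)
qed

text \<open>This is where \<open>bp\<close> is told from \<open>bs\<close> and, dually,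
  \<open>olh\<close> from \<open>olc\<close>: what a colouring shows on just two objects.\<close>

lemma partition_restrict_pair:
  assumes K: "partition_on C K" and uv: "u \<in> C" "v \<in> C" "u \<noteq> v"
  shows "(\<lambda>c. c \<inter> {u, v}) ` K - {{}} = (if \<exists>c\<in>K. u \<in> c \<and> v \<in> c then {{u, v}} else {{u}, {v}})"
proof -
  obtain c where c: "c \<in> K" "u \<in> c" using partition_on_blockE[OF K uv(1)] .
  obtain d where d: "d \<in> K" "v \<in> d" using partition_on_blockE[OF K uv(2)] .
  have cu: "b = c" if "b \<in> K" "u \<in> b" for b using partition_on_block_unique[OF K] c that by blast
  have dv: "b = d" if "b \<in> K" "v \<in> b" for b using partition_on_block_unique[OF K] d that by blast
  have "b \<inter> {u, v} = {}" if "b \<in> K" "b \<noteq> c" "b \<noteq> d" for b using that cu dv by blast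
  note other = this
  have "(\<lambda>c. c \<inter> {u, v}) ` K - {{}} = {c \<inter> {u, v}, d \<inter> {u, v}}"
  proof (intro equalityI subsetI)
    fix S assume "S \<in> (\<lambda>c. c \<inter> {u, v}) ` K - {{}}"
    then obtain b where "b \<in> K" "S = b \<inter> {u, v}" "S \<noteq> {}" by auto
    then have "b = c \<or> b = d" using other by metis
    then show "S \<in> {c \<inter> {u, v}, d \<inter> {u, v}}" using \<open>S = _\<close> by blast
  next
    fix S assume "S \<in> {c \<inter> {u, v}, d \<inter> {u, v}}"
    then consider "S = c \<inter> {u, v}" | "S = d \<inter> {u, v}" by blast
    then show "S \<in> (\<lambda>c. c \<inter> {u, v}) ` K - {{}}" using c d by cases auto
  qed
  also have "\<dots> = (if \<exists>c\<in>K. u \<in> c \<and> v \<in> c then {{u, v}} else {{u}, {v}})"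
  proof (cases "c = d")
    case True
    then show ?thesis using c d by auto
  next
    case False
    then have "v \<notin> c" "u \<notin> d" using cu[of d] dv[of c] c d by blast+
    then have "\<not> (\<exists>c\<in>K. u \<in> c \<and> v \<in> c)" using cu by blast
    moreover have "c \<inter> {u, v} = {u}" "d \<inter> {u, v} = {v}" using \<open>v \<notin> c\<close> \<open>u \<notin> d\<close> c d by auto
    ultimately show ?thesis by (simp only: if_False)
  qed
  finally show ?thesis .
qed

lemma edge_points:
  assumes "ribbon_graph G" "e \<in> edges G" "x \<in> e"
  defines "y \<equiv> seg G x" and "z \<equiv> side G x" and "w \<equiv> seg G (side G x)"
  shows "e = {x, y, z, w}" "distinct [x, y, z, w]"
    "seg G x = y" "seg G y = x" "seg G z = w" "seg G w = z"
    "side G x = z" "side G z = x" "side G y = w" "side G w = y"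
proof -
  note seg = fpf_involution_onD[OF ribbon_graphD(3)[OF assms(1)]]
  note side = fpf_involution_onD[OF ribbon_graphD(4)[OF assms(1)]]
  have x: "x \<in> pts G" using edge_subset[OF assms(1,2)] assms(3) by blast
  show "e = {x, y, z, w}" using edge_eq(1)[OF assms(1-3)] by (simp add: y_def z_def w_def)
  show sxy: "seg G x = y" "seg G y = x" "seg G z = w" "seg G w = z" "side G x = z" "side G z = x"
    using x seg side by (auto simp: y_def z_def w_def)
  have comm: "w = side G y" using ribbon_graphD(5)[OF assms(1) x] by (simp add: y_def w_def)
  have y: "y \<in> pts G" and z: "z \<in> pts G" using x seg side by (auto simp: y_def z_def)
  show "side G y = w" "side G w = y" using comm side(3)[OF y] by auto
  have "y \<noteq> z" using edge_eq(2)[OF assms(1-3)] by (simp add: y_def z_def)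
  moreover have "x \<noteq> y" "x \<noteq> z" "z \<noteq> w" "y \<noteq> w"
    using seg(2)[OF x] side(2)[OF x] seg(2)[OF z] side(2)[OF y] sxy comm by auto
  moreover have "x \<noteq> w" using \<open>y \<noteq> z\<close> sxy by metis
  ultimately show "distinct [x, y, z, w]" by simp
qed


lemma conn_subset_crel:
  assumes "partition_on (P // conn R) K" "R \<subseteq> P \<times> P"
  shows "conn R \<subseteq> conn (crel K)"
proof (rule conn_subI)
  fix a b assume ab: "(a, b) \<in> R"
  then have "conn R `` {a} \<in> P // conn R" using assms(2) by (intro quotientI) blast
  then obtain c where c: "c \<in> K" "conn R `` {a} \<in> c"
    using partition_on_blockE[OF assms(1)] by blast
  have "a \<in> \<Union>c" "b \<in> \<Union>c" using c(2) conn_incl[OF ab] by (auto intro: conn_refl)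
  then show "(a, b) \<in> conn (crel K)" using c(1) by (intro conn_incl) (auto simp: crel_def)
qed

section \<open>The graph with a single edge, cut along that edge\<close>

context
  fixes H :: "'a coloured_ribbon" and e :: "'a set" and x :: 'a
  assumes H: "coloured_ribbon_graph H" and edges_H: "edges H = {e}" and x_e: "x \<in> e"
begin

private abbreviation "f \<equiv> arc H"
private abbreviation "s \<equiv> seg H"
private abbreviation "d \<equiv> side H"
private abbreviation "P \<equiv> pts H"
private abbreviation "y \<equiv> seg H x"
private abbreviation "z \<equiv> side H x"
private abbreviation "w \<equiv> seg H (side H x)"

text \<open>The components of \<open>R0\<close> that meet the edge are two paths, which join its four points in pairs.\<close>

private definition "R0 = gr P f \<union> gr (P - e) s"
private definition "Rv = gr P f \<union> gr P s"
private definition "Rb = gr P f \<union> gr P d"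
text \<open>These are the points that \<open>remove_isolated\<close> keeps (\<open>W_eq\<close>).
  Describing them by \<open>R0\<close> treats vertices and boundary components alike.\<close>

private definition "W = {a. \<exists>q\<in>e. (q, a) \<in> conn R0}"

private lemma rH: "ribbon_graph H"
  using H by (rule coloured_ribbon_graphD)

private lemma e_edge: "e \<in> edges H"
  by (simp add: edges_H)

private lemmas fD = fpf_involution_onD[OF ribbon_graphD(2)[OF rH]]
private lemmas sD = fpf_involution_onD[OF ribbon_graphD(3)[OF rH]]
private lemmas dD = fpf_involution_onD[OF ribbon_graphD(4)[OF rH]]
private lemmas e_P = edge_subset[OF rH e_edge]
private lemmas ep = edge_points[OF rH e_edge x_e]
private lemmas e_closed = edge_closed[OF rH e_edge]

private lemma seg_eq_side: "a \<in> P \<Longrightarrow> a \<notin> e \<Longrightarrow> d a = s a"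
  using in_Union_edges_iff[OF rH, of a] by (simp add: edges_H)

private lemma xyzw_e: "x \<in> e" "y \<in> e" "z \<in> e" "w \<in> e"
  using ep(1) by blast+

private lemma xyzw_P: "x \<in> P" "y \<in> P" "z \<in> P" "w \<in> P"
  using xyzw_e e_P by blast+

private lemma R0_sub: "R0 \<subseteq> P \<times> P"
  using fD sD by (auto simp: R0_def)

private lemma Rv_eq: "conn Rv = conn (insert (x, y) (insert (z, w) R0))"
proof (rule conn_eqI)
  fix a b assume ab: "(a, b) \<in> Rv"
  have "(a, b) \<in> conn (insert (x, y) (insert (z, w) R0))" if "a \<in> e" "b = s a"
  proof -
    have "a \<in> {x, y, z, w}" using that(1) ep(1) by blast
    then have "(a, b) \<in> {(x, y), (y, x), (z, w), (w, z)}" using ep(3-6) that(2) by auto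
    then have "(a, b) \<in> insert (x, y) (insert (z, w) R0) \<or> (b, a) \<in> insert (x, y) (insert (z, w) R0)" by blast
    then show ?thesis using conn_incl conn_sym by metis
  qed
  then show "(a, b) \<in> conn (insert (x, y) (insert (z, w) R0))"
    using ab by (cases "a \<in> e") (auto simp: Rv_def R0_def intro: conn_incl)
next
  have "insert (x, y) (insert (z, w) R0) \<subseteq> Rv"
    unfolding Rv_def R0_def using xyzw_P by auto
  then show "(a, b) \<in> conn Rv" if "(a, b) \<in> insert (x, y) (insert (z, w) R0)" for a b
    using that by (blast intro: conn_incl)
qed

text \<open>Points off \<open>e\<close> belong to marks, where \<open>side\<close> and
  \<open>seg\<close> agree. Vertices and boundary components therefore extend the same relation
  \<open>R0\<close>, the former by the two segments of \<open>e\<close>, the latter by its two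
  sides.\<close>

private lemma Rb_eq: "conn Rb = conn (insert (x, z) (insert (y, w) R0))"
proof (rule conn_eqI)
  fix a b assume ab: "(a, b) \<in> Rb"
  have "(a, b) \<in> conn (insert (x, z) (insert (y, w) R0))" if "a \<in> e" "b = d a"
  proof -
    have "a \<in> {x, y, z, w}" using that(1) ep(1) by blast
    then have "(a, b) \<in> {(x, z), (z, x), (y, w), (w, y)}" using ep(7-10) that(2) by auto
    then have "(a, b) \<in> insert (x, z) (insert (y, w) R0) \<or> (b, a) \<in> insert (x, z) (insert (y, w) R0)" by blast
    then show ?thesis using conn_incl conn_sym by metis
  qed
  then show "(a, b) \<in> conn (insert (x, z) (insert (y, w) R0))"
    using ab seg_eq_side[of a] by (cases "a \<in> e") (auto simp: Rb_def R0_def intro: conn_incl)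
next
  have "gr (P - e) s \<subseteq> gr P d" using seg_eq_side by auto
  then have "insert (x, z) (insert (y, w) R0) \<subseteq> Rb"
    unfolding Rb_def R0_def using xyzw_P ep(9) by auto
  then show "(a, b) \<in> conn Rb" if "(a, b) \<in> insert (x, z) (insert (y, w) R0)" for a b
    using that by (blast intro: conn_incl)
qed

private lemma verts_H: "verts H = P // conn Rv"
  unfolding verts_def Rv_def by (rule curves_eq_quotient) (rule ribbon_graphD[OF rH])+

private lemma bounds_H: "bounds H = P // conn Rb"
  unfolding bounds_def Rb_def by (rule curves_eq_quotient) (rule ribbon_graphD[OF rH])+

text \<open>Contracting the only edge replaces its segments by its sides, so the vertices after
  contraction are the boundary components of \<open>H\<close>.\<close>

private lemma vnum_H:
  "vnum H {} = card (P // conn (insert (x, y) (insert (z, w) R0)))"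
  "vnum H {e} = card (P // conn (insert (x, z) (insert (y, w) R0)))"
proof -
  show "vnum H {} = card (P // conn (insert (x, y) (insert (z, w) R0)))"
    by (simp add: vnum_def Rv_eq[symmetric] Rv_def)
  have "gr P (\<lambda>a. if a \<in> \<Union>{e} then d a else s a) = gr P d"
    using seg_eq_side by (auto simp: gr_def)
  then show "vnum H {e} = card (P // conn (insert (x, z) (insert (y, w) R0)))"
    unfolding vnum_def Rb_eq[symmetric] Rb_def by simp
qed

text \<open>When \<open>e\<close> already falls into two connected pairs, linking all its points
  amounts to one new pair and costs at most one class. The pairs are the segments for vertex colours
  and the sides for boundary colours.\<close>

private lemma conn_clique_pairs:
  assumes "(a, b) \<in> conn R" "(a', b') \<in> conn R" "e = {a, b, a', b'}"
  shows "conn (R \<union> e \<times> e) = conn (insert (a, a') R)"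
proof (rule conn_eqI)
  let ?C = "conn (insert (a, a') R)"
  have "conn R \<subseteq> ?C" by (rule conn_mono) auto
  then have "(a, b) \<in> ?C" "(a, a') \<in> ?C" "(a', b') \<in> ?C"
    using assms(1,2) by (auto intro: conn_incl)
  then have "(a, p) \<in> ?C" if "p \<in> e" for p
    using that assms(3) conn_trans[of a a' _ b'] by auto
  then have "(p, q) \<in> ?C" if "p \<in> e" "q \<in> e" for p q
    using that conn_sym conn_trans by metis
  then show "(p, q) \<in> ?C" if "(p, q) \<in> R \<union> e \<times> e" for p q
    using that by (auto intro: conn_incl)
next
  have "insert (a, a') R \<subseteq> R \<union> e \<times> e" using assms(3) by auto
  then show "(p, q) \<in> conn (R \<union> e \<times> e)" if "(p, q) \<in> insert (a, a') R" for p q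
    using that by (blast intro: conn_incl)
qed

private lemma Rv_vcol: "conn Rv \<subseteq> conn (crel (vcol H))"
  using coloured_ribbon_graphD(2)[OF H] gr_Un_subset[OF ribbon_graphD(2,3)[OF rH]]
  unfolding verts_H Rv_def by (rule conn_subset_crel)

private lemma Rb_bcol: "conn Rb \<subseteq> conn (crel (bcol H))"
  using coloured_ribbon_graphD(3)[OF H] gr_Un_subset[OF ribbon_graphD(2,4)[OF rH]]
  unfolding bounds_H Rb_def by (rule conn_subset_crel)

private lemma in_Rv: "(x, y) \<in> conn Rv" "(z, w) \<in> conn Rv" "conn R0 \<subseteq> conn Rv"
  unfolding Rv_eq by (simp_all add: conn_incl conn_mono subset_insertI2)

private lemma in_Rb: "(x, z) \<in> conn Rb" "(y, w) \<in> conn Rb" "conn R0 \<subseteq> conn Rb"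
  unfolding Rb_eq by (simp_all add: conn_incl conn_mono subset_insertI2)

private lemma vcnum_H:
  "vcnum H {} = card (P // conn (crel (vcol H)))"
  "vcnum H {e} = card (P // conn (insert (x, z) (crel (vcol H))))"
proof -
  have "conn (crel (vcol H) \<union> e \<times> e) = conn (insert (x, z) (crel (vcol H)))"
    by (rule conn_clique_pairs[OF _ _ ep(1)]) (use in_Rv Rv_vcol in blast)+
  then show "vcnum H {} = card (P // conn (crel (vcol H)))"
    "vcnum H {e} = card (P // conn (insert (x, z) (crel (vcol H))))"
    by (simp_all add: vcnum_def clq_def)
qed

private lemma bcnum_H:
  "bcnum H {} = card (P // conn (insert (x, y) (crel (bcol H))))"
  "bcnum H {e} = card (P // conn (crel (bcol H)))"
proof -
  have "conn (crel (bcol H) \<union> e \<times> e) = conn (insert (x, y) (crel (bcol H)))"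
    by (rule conn_clique_pairs[of x z _ y w]) (use in_Rb Rb_bcol ep(1) in blast)+
  then show "bcnum H {} = card (P // conn (insert (x, y) (crel (bcol H))))"
    "bcnum H {e} = card (P // conn (crel (bcol H)))"
    by (simp_all add: bcnum_def clq_def edges_H)
qed

private lemma W_iff: "(a, b) \<in> conn R0 \<Longrightarrow> a \<in> W \<longleftrightarrow> b \<in> W"
  using conn_trans[of _ a R0 b] conn_trans[of _ b R0 a] conn_sym[of a b R0] unfolding W_def by blast

private lemma e_W: "e \<subseteq> W"
  by (auto simp: W_def intro: conn_refl)

private lemma W_P: "W \<subseteq> P"
  using conn_mem_iff[OF _ R0_sub] e_P by (auto simp: W_def)

private lemma W_closed:
  assumes "a \<in> W" shows "f a \<in> W" "s a \<in> W" "d a \<in> W"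
proof -
  have a: "a \<in> P" using assms W_P by blast
  then have "(a, f a) \<in> conn R0" by (intro conn_incl) (simp add: R0_def)
  then show "f a \<in> W" using W_iff assms by blast
  show "s a \<in> W"
  proof (cases "a \<in> e")
    case False
    then have "(a, s a) \<in> conn R0" using a by (intro conn_incl) (simp add: R0_def)
    then show ?thesis using W_iff assms by blast
  qed (use e_closed e_W in blast)
  then show "d a \<in> W"
    using seg_eq_side[OF a] e_closed e_W by (cases "a \<in> e") auto
qed

private lemma W_conn: "(a, b) \<in> conn Rv \<Longrightarrow> a \<in> W \<longleftrightarrow> b \<in> W" "(a, b) \<in> conn Rb \<Longrightarrow> a \<in> W \<longleftrightarrow> b \<in> W"
proof -
  have *: "a \<in> W \<longleftrightarrow> b \<in> W" if "a \<in> P" "b = f a \<or> b = s a \<or> b = d a" for a b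
    using that W_closed[of a] W_closed[of b] fD(3) sD(3) dD(3) by metis
  show "(a, b) \<in> conn Rv \<Longrightarrow> a \<in> W \<longleftrightarrow> b \<in> W"
    by (erule conn_invariant) (use * in \<open>auto simp: Rv_def\<close>)
  show "(a, b) \<in> conn Rb \<Longrightarrow> a \<in> W \<longleftrightarrow> b \<in> W"
    by (erule conn_invariant) (use * in \<open>auto simp: Rb_def\<close>)
qed

private lemma W_classes:
  "{v \<in> verts H. v \<subseteq> W} = (\<lambda>q. conn Rv `` {q}) ` e"
  "{v \<in> bounds H. v \<subseteq> W} = (\<lambda>q. conn Rb `` {q}) ` e"
proof -
  have *: "{v \<in> P // conn R. v \<subseteq> W} = (\<lambda>q. conn R `` {q}) ` e"
    if R: "conn R0 \<subseteq> conn R" and W: "\<And>a b. (a, b) \<in> conn R \<Longrightarrow> a \<in> W \<longleftrightarrow> b \<in> W" for R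
  proof (intro equalityI subsetI)
    fix v assume "v \<in> {v \<in> P // conn R. v \<subseteq> W}"
    then obtain a where a: "v = conn R `` {a}" "v \<subseteq> W" by (auto simp: quotient_def)
    then have "a \<in> W" by auto
    then obtain q where "q \<in> e" "(q, a) \<in> conn R" using R by (auto simp: W_def)
    then show "v \<in> (\<lambda>q. conn R `` {q}) ` e"
      unfolding a(1) by (metis conn_class_eq_iff imageI)
  next
    fix v assume "v \<in> (\<lambda>q. conn R `` {q}) ` e"
    then obtain q where "q \<in> e" "v = conn R `` {q}" by blast
    then show "v \<in> {v \<in> P // conn R. v \<subseteq> W}"
      using e_P e_W W by (auto simp: quotient_def)
  qed
  show "{v \<in> verts H. v \<subseteq> W} = (\<lambda>q. conn Rv `` {q}) ` e"
    unfolding verts_H using in_Rv(3) W_conn(1) by (rule *)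
  show "{v \<in> bounds H. v \<subseteq> W} = (\<lambda>q. conn Rb `` {q}) ` e"
    unfolding bounds_H using in_Rb(3) W_conn(2) by (rule *)
qed

private lemma W_verts: "{v \<in> verts H. v \<subseteq> W} = {conn Rv `` {x}, conn Rv `` {z}}"
proof -
  have "conn Rv `` {x} = conn Rv `` {y}" "conn Rv `` {z} = conn Rv `` {w}"
    using in_Rv by (simp_all add: conn_class_eq_iff)
  then show ?thesis unfolding W_classes by (subst ep(1)) auto
qed

private lemma W_bounds: "{v \<in> bounds H. v \<subseteq> W} = {conn Rb `` {x}, conn Rb `` {y}}"
proof -
  have "conn Rb `` {x} = conn Rb `` {z}" "conn Rb `` {y} = conn Rb `` {w}"
    using in_Rb by (simp_all add: conn_class_eq_iff)
  then show ?thesis unfolding W_classes by (subst ep(1)) auto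
qed

private lemma W_eq: "\<Union>{v \<in> verts H. \<exists>e\<in>edges H. v \<inter> e \<noteq> {}} = W"
proof -
  have "v \<subseteq> W \<longleftrightarrow> v \<inter> e \<noteq> {}" if "v \<in> verts H" for v
  proof
    assume "v \<subseteq> W"
    then have "v \<in> (\<lambda>q. conn Rv `` {q}) ` e" using that W_classes(1) by blast
    then show "v \<inter> e \<noteq> {}" using conn_refl[of _ Rv] by blast
  next
    assume "v \<inter> e \<noteq> {}"
    then obtain q where q: "q \<in> v" "q \<in> e" by blast
    obtain a where "v = conn Rv `` {a}" using \<open>v \<in> verts H\<close> by (auto simp: verts_H quotient_def)
    then show "v \<subseteq> W" using q W_conn(1) e_W by (metis Image_singleton_iff subsetD subsetI)
  qed
  then have *: "{v \<in> verts H. \<exists>e\<in>edges H. v \<inter> e \<noteq> {}} = {v \<in> verts H. v \<subseteq> W}"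
    by (auto simp: edges_H)
  show ?thesis
    unfolding *
  proof (intro equalityI subsetI)
    fix a assume a: "a \<in> W"
    have "conn Rv `` {a} \<subseteq> W" using W_conn(1) a by blast
    moreover have "conn Rv `` {a} \<in> verts H" using a W_P by (auto simp: verts_H quotient_def)
    moreover have "a \<in> conn Rv `` {a}" by simp
    ultimately show "a \<in> \<Union>{v \<in> verts H. v \<subseteq> W}" by blast
  qed blast
qed

section \<open>The one-edge graph without isolated vertices\<close>

private definition "H' = remove_isolated H"

private lemma H'_simps:
  "pts H' = W" "arc H' = f" "seg H' = s" "side H' = d"
  "vcol H' = (\<lambda>c. {v \<in> c. v \<subseteq> W}) ` vcol H - {{}}"
  "bcol H' = (\<lambda>c. {v \<in> c. v \<subseteq> W}) ` bcol H - {{}}"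
  unfolding H'_def remove_isolated_def W_eq Let_def by simp_all

private lemma H'_curves: "verts H' = {v \<in> verts H. v \<subseteq> W}" "bounds H' = {v \<in> bounds H. v \<subseteq> W}"
  unfolding verts_def bounds_def H'_simps
  using ribbon_graphD[OF rH] W_P W_closed by (intro curves_restrict; simp)+

private lemma H'_edges: "edges H' = {e}"
proof -
  have "edges H' = {{a, s a, d a, s (d a)} |a. a \<in> W \<and> a \<in> e}"
    unfolding edges_def H'_simps using W_P in_Union_edges_iff[OF rH] edges_H by auto
  also have "\<dots> = (\<lambda>a. e) ` e"
    using e_W edge_eq(1)[OF rH e_edge] by (auto simp: image_iff)
  finally show ?thesis using x_e by auto
qed

private lemma
  W_vcol: "(\<lambda>c. {v \<in> c. v \<subseteq> W}) ` vcol H - {{}} =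
     (\<lambda>c. c \<inter> {conn Rv `` {x}, conn Rv `` {z}}) ` vcol H - {{}}" and
  W_bcol: "(\<lambda>c. {v \<in> c. v \<subseteq> W}) ` bcol H - {{}} =
     (\<lambda>c. c \<inter> {conn Rb `` {x}, conn Rb `` {y}}) ` bcol H - {{}}"
proof -
  have "{v \<in> c. v \<subseteq> W} = c \<inter> {conn Rv `` {x}, conn Rv `` {z}}" if "c \<in> vcol H" for c
  proof -
    have "c \<subseteq> verts H" using that coloured_ribbon_graphD(2)[OF H] by (auto simp: partition_on_def)
    then show ?thesis using W_verts by blast
  qed
  then show "(\<lambda>c. {v \<in> c. v \<subseteq> W}) ` vcol H - {{}} =
     (\<lambda>c. c \<inter> {conn Rv `` {x}, conn Rv `` {z}}) ` vcol H - {{}}"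
    by (metis (no_types, lifting) image_cong)
  have "{v \<in> c. v \<subseteq> W} = c \<inter> {conn Rb `` {x}, conn Rb `` {y}}" if "c \<in> bcol H" for c
  proof -
    have "c \<subseteq> bounds H" using that coloured_ribbon_graphD(3)[OF H] by (auto simp: partition_on_def)
    then show ?thesis using W_bounds by blast
  qed
  then show "(\<lambda>c. {v \<in> c. v \<subseteq> W}) ` bcol H - {{}} =
     (\<lambda>c. c \<inter> {conn Rb `` {x}, conn Rb `` {y}}) ` bcol H - {{}}"
    by (metis (no_types, lifting) image_cong)
qed

private lemma same_vcol: "(\<exists>c\<in>vcol H. conn Rv `` {a} \<in> c \<and> conn Rv `` {b} \<in> c) \<longleftrightarrow> (a, b) \<in> conn (crel (vcol H))"
  if "a \<in> P" "b \<in> P"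
proof -
  note cH = coloured_ribbon_graphD[OF H]
  have *: "conn Rv `` {p} \<in> c \<longleftrightarrow> p \<in> \<Union>c" if "c \<in> vcol H" "p \<in> P" for c p
  proof
    assume "p \<in> \<Union>c"
    then obtain v where v: "v \<in> c" "p \<in> v" by blast
    then have "v \<in> verts H" using cH(2) that(1) by (auto simp: partition_on_def)
    moreover have "conn Rv `` {p} \<in> verts H" using that(2) by (simp add: verts_H quotientI)
    ultimately show "conn Rv `` {p} \<in> c"
      using partition_on_block_unique[OF cH(4)] v conn_refl[of p Rv] by blast
  qed (auto intro: conn_refl)
  show ?thesis
    unfolding conn_crel_iff[OF cH(4,2) that(1)] crel_iff
    by (intro bex_cong refl) (simp add: * that del: Union_iff)
qed

private lemma same_bcol: "(\<exists>c\<in>bcol H. conn Rb `` {a} \<in> c \<and> conn Rb `` {b} \<in> c) \<longleftrightarrow> (a, b) \<in> conn (crel (bcol H))"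
  if "a \<in> P" "b \<in> P"
proof -
  note cH = coloured_ribbon_graphD[OF H]
  have *: "conn Rb `` {p} \<in> c \<longleftrightarrow> p \<in> \<Union>c" if "c \<in> bcol H" "p \<in> P" for c p
  proof
    assume "p \<in> \<Union>c"
    then obtain v where v: "v \<in> c" "p \<in> v" by blast
    then have "v \<in> bounds H" using cH(3) that(1) by (auto simp: partition_on_def)
    moreover have "conn Rb `` {p} \<in> bounds H" using that(2) by (simp add: bounds_H quotientI)
    ultimately show "conn Rb `` {p} \<in> c"
      using partition_on_block_unique[OF cH(5)] v conn_refl[of p Rb] by blast
  qed (auto intro: conn_refl)
  show ?thesis
    unfolding conn_crel_iff[OF cH(5,3) that(1)] crel_iff
    by (intro bex_cong refl) (simp add: * that del: Union_iff)
qed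

private lemma s_inv: "fpf_involution_on (P - e) s"
  using sD edge_closed_iff[OF rH e_edge] by (auto simp: fpf_involution_on_def)

private lemmas path = path_end[OF ribbon_graphD(1,2)[OF rH] e_P s_inv, folded R0_def]

private lemma path_ex:
  assumes "a \<in> e"
  shows "\<exists>b p. b \<in> e \<and> b \<noteq> a \<and> (a, b) \<in> conn R0 \<and>
    (\<forall>u\<in>e. (a, u) \<in> conn R0 \<longrightarrow> u = a \<or> u = b) \<and> p a \<and> \<not> p b \<and>
    (\<forall>c. (a, c) \<in> conn R0 \<longrightarrow> p (f c) = (\<not> p c)) \<and>
    (\<forall>c. (a, c) \<in> conn R0 \<longrightarrow> c \<notin> e \<longrightarrow> p (s c) = (\<not> p c))"
proof (rule path[OF assms])
  fix b p
  assume "b \<in> e" "b \<noteq> a" "(a, b) \<in> conn R0" "\<And>u. u \<in> e \<Longrightarrow> (a, u) \<in> conn R0 \<Longrightarrow> u = a \<or> u = b"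
    "p a" "\<not> p b" "\<And>c. (a, c) \<in> conn R0 \<Longrightarrow> p (f c) = (\<not> p c)"
    "\<And>c. (a, c) \<in> conn R0 \<Longrightarrow> c \<notin> e \<Longrightarrow> p (s c) = (\<not> p c)"
  then show ?thesis by (intro exI[of _ b] exI[of _ p]) blast
qed

private lemmas card_insert = card_quotient_conn_insert[OF ribbon_graphD(1)[OF rH]]

private lemma conn_insertI: "(a, b) \<in> conn R \<Longrightarrow> (a, b) \<in> conn (insert p R)"
  using conn_mono[of R "insert p R"] by blast

text \<open>Each point of \<open>e\<close> is joined to exactly one of the other three, so the
  partner of \<open>x\<close> decides everything. Paths parallel to the segments give a non-loop,
  paths parallel to the sides an orientable loop, and diagonal paths a non-orientable loop.\<close>

private lemma pairing:
  obtains "(x, y) \<in> conn R0" "(z, w) \<in> conn R0" "(x, z) \<notin> conn R0"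
  | "(x, z) \<in> conn R0" "(y, w) \<in> conn R0" "(x, y) \<notin> conn R0"
  | "(x, w) \<in> conn R0" "(y, z) \<in> conn R0" "(x, y) \<notin> conn R0" "(x, z) \<notin> conn R0"
proof -
  have partner: "\<exists>b\<in>e. b \<noteq> a \<and> (a, b) \<in> conn R0 \<and> (\<forall>u\<in>e. (a, u) \<in> conn R0 \<longrightarrow> u = a \<or> u = b)"
    if "a \<in> e" for a
    using path_ex[OF that] by blast
  obtain b where b: "b \<in> e" "b \<noteq> x" "(x, b) \<in> conn R0"
    and b': "\<And>u. u \<in> e \<Longrightarrow> (x, u) \<in> conn R0 \<Longrightarrow> u = x \<or> u = b"
    using partner[OF xyzw_e(1)] by blast
  have split: "(p, q) \<in> conn R0" if pq: "e = {x, b, p, q}" "distinct [x, b, p, q]" for p q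
  proof -
    have "p \<in> e" using pq(1) by blast
    then obtain c where c: "c \<in> e" "c \<noteq> p" "(p, c) \<in> conn R0" using partner by blast
    have "(x, p) \<notin> conn R0" using b'[OF \<open>p \<in> e\<close>] pq(2) by auto
    then have "c \<noteq> x" "c \<noteq> b"
      using c(3) b(3) conn_sym conn_trans by metis+
    then have "c = q" using c(1,2) pq(1) by blast
    then show ?thesis using c(3) by simp
  qed
  have "b = y \<or> b = z \<or> b = w" using b(1,2) ep(1) by blast
  then show thesis
  proof (elim disjE)
    assume "b = y"
    moreover have "(z, w) \<in> conn R0" using ep(1,2) \<open>b = y\<close> by (intro split) auto
    moreover have "(x, z) \<notin> conn R0" using b'[OF xyzw_e(3)] ep(2) \<open>b = y\<close> by auto
    ultimately show thesis using that(1) b(3) by blast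
  next
    assume "b = z"
    moreover have "(y, w) \<in> conn R0" using ep(1,2) \<open>b = z\<close> by (intro split) auto
    moreover have "(x, y) \<notin> conn R0" using b'[OF xyzw_e(2)] ep(2) \<open>b = z\<close> by auto
    ultimately show thesis using that(2) b(3) by blast
  next
    assume "b = w"
    moreover have "(y, z) \<in> conn R0" using ep(1,2) \<open>b = w\<close> by (intro split) auto
    moreover have "(x, y) \<notin> conn R0" "(x, z) \<notin> conn R0"
      using b'[OF xyzw_e(2)] b'[OF xyzw_e(3)] ep(2) \<open>b = w\<close> by auto
    ultimately show thesis using that(3) b(3) by blast
  qed
qed

private lemma orientable_H':
  assumes xz: "(x, z) \<in> conn R0" and yw: "(y, w) \<in> conn R0" and xy: "(x, y) \<notin> conn R0"
  shows "orientable H'"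
proof -
  obtain b p where b: "b \<in> e" "b \<noteq> x" "(x, b) \<in> conn R0"
    and bu: "\<And>u. u \<in> e \<Longrightarrow> (x, u) \<in> conn R0 \<Longrightarrow> u = x \<or> u = b"
    and bp: "p x" "\<not> p b"
    and pf: "\<And>a. (x, a) \<in> conn R0 \<Longrightarrow> p (f a) \<longleftrightarrow> \<not> p a"
    and ps: "\<And>a. (x, a) \<in> conn R0 \<Longrightarrow> a \<notin> e \<Longrightarrow> p (s a) \<longleftrightarrow> \<not> p a"
    using path_ex[OF xyzw_e(1)] by blast
  have "b = z" using bu[OF xyzw_e(3) xz] ep(2) by auto
  obtain c q where c: "c \<in> e" "c \<noteq> y" "(y, c) \<in> conn R0"
    and cu: "\<And>u. u \<in> e \<Longrightarrow> (y, u) \<in> conn R0 \<Longrightarrow> u = y \<or> u = c"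
    and cq: "q y" "\<not> q c"
    and qf: "\<And>a. (y, a) \<in> conn R0 \<Longrightarrow> q (f a) \<longleftrightarrow> \<not> q a"
    and qs: "\<And>a. (y, a) \<in> conn R0 \<Longrightarrow> a \<notin> e \<Longrightarrow> q (s a) \<longleftrightarrow> \<not> q a"
    using path_ex[OF xyzw_e(2)] by blast
  have "c = w" using cu[OF xyzw_e(4) yw] ep(2) by auto
  \<comment> \<open>The path from \<open>y\<close> takes its values reversed: then \<open>x\<close>
    and \<open>w\<close> get one value and \<open>y\<close> and \<open>z\<close> the other, as the
    segments and sides of \<open>e\<close> demand.\<close>
  define r where "r a \<longleftrightarrow> (if (x, a) \<in> conn R0 then p a else \<not> q a)" for a
  have "(x, w) \<notin> conn R0" using xy yw conn_sym conn_trans by metis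
  then have r: "r x" "\<not> r y" "\<not> r z" "r w"
    using bp cq xz xy \<open>b = z\<close> \<open>c = w\<close> by (simp_all add: r_def)
  have xa: "(x, a) \<in> conn R0 \<or> (x, a) \<notin> conn R0 \<and> (y, a) \<in> conn R0" if "a \<in> W" for a
  proof -
    obtain q where q: "q \<in> e" "(q, a) \<in> conn R0" using \<open>a \<in> W\<close> by (auto simp: W_def)
    have "q = x \<or> q = y \<or> q = z \<or> q = w" using q(1) ep(1) by blast
    then consider "(x, q) \<in> conn R0" | "(y, q) \<in> conn R0" using xz yw by auto
    then show ?thesis using q(2) conn_trans[of _ q R0 a] by cases auto
  qed
  have same: "(x, b) \<in> conn R0 \<longleftrightarrow> (x, a) \<in> conn R0" if "(a, b) \<in> R0" for a b
    using conn_incl[OF that] conn_sym conn_trans by metis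
  have rf: "r (f a) \<noteq> r a" if "a \<in> W" for a
  proof -
    have "(a, f a) \<in> R0" using that W_P by (auto simp: R0_def)
    then show ?thesis using same[of a "f a"] xa[OF that] pf[of a] qf[of a] by (auto simp: r_def)
  qed
  have rs: "r (s a) \<noteq> r a" if "a \<in> W" "a \<notin> e" for a
  proof -
    have "(a, s a) \<in> R0" using that W_P by (auto simp: R0_def)
    then show ?thesis using same[of a "s a"] xa[OF that(1)] ps[OF _ that(2)] qs[OF _ that(2)] by (auto simp: r_def)
  qed
  have "r (s a) \<noteq> r a \<and> r (d a) \<noteq> r a" if "a \<in> e" for a
  proof -
    have "a = x \<or> a = y \<or> a = z \<or> a = w" using that ep(1) by blast
    then show ?thesis using r ep(4,6,8-10) by (elim disjE) simp_all
  qed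
  then have "r (s a) \<noteq> r a \<and> r (d a) \<noteq> r a" if "a \<in> W" for a
    using rs[OF that] seg_eq_side[of a] that W_P by (cases "a \<in> e") auto
  then have "\<forall>a\<in>W. r (f a) \<noteq> r a \<and> r (s a) \<noteq> r a \<and> r (d a) \<noteq> r a" using rf by blast
  then show ?thesis unfolding orientable_def H'_simps by (intro exI[of _ r])
qed

text \<open>An orientation flips at every generator of the path from \<open>x\<close> to
  \<open>w\<close> and hence differs at its ends. But \<open>w\<close> is also reached from
  \<open>x\<close> by one segment and one side, which makes two flips.\<close>

private lemma not_orientable_H':
  assumes xw: "(x, w) \<in> conn R0"
  shows "\<not> orientable H'"
proof
  assume "orientable H'"
  then obtain q where q: "\<And>a. a \<in> W \<Longrightarrow> q (f a) \<noteq> q a \<and> q (s a) \<noteq> q a \<and> q (d a) \<noteq> (q a :: bool)"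
    unfolding orientable_def H'_simps by blast
  obtain b p where b: "b \<in> e" "b \<noteq> x" "(x, b) \<in> conn R0"
    and bu: "\<And>u. u \<in> e \<Longrightarrow> (x, u) \<in> conn R0 \<Longrightarrow> u = x \<or> u = b"
    and bp: "p x" "\<not> p b"
    and pf: "\<And>a. (x, a) \<in> conn R0 \<Longrightarrow> p (f a) \<longleftrightarrow> \<not> p a"
    and ps: "\<And>a. (x, a) \<in> conn R0 \<Longrightarrow> a \<notin> e \<Longrightarrow> p (s a) \<longleftrightarrow> \<not> p a"
    using path_ex[OF xyzw_e(1)] by blast
  have "b = w" using bu[OF xyzw_e(4) xw] ep(2) by auto
  have "q x \<longleftrightarrow> \<not> q w"
    using xw bp(1)
  proof (rule path_end_alternating)
    show "\<not> p w" using bp(2) \<open>b = w\<close> by simp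
    fix a b assume ab: "(a, b) \<in> R0" "(x, a) \<in> conn R0"
    have "a \<in> W" using ab(2) W_iff e_W x_e by blast
    then show "(p b \<longleftrightarrow> \<not> p a) \<and> (q b \<longleftrightarrow> \<not> q a)"
      using ab(1) pf[OF ab(2)] ps[OF ab(2)] q[OF \<open>a \<in> W\<close>] by (auto simp: R0_def)
  qed
  moreover have "q y \<noteq> q x" using q[of x] e_W x_e by auto
  moreover have "q w \<noteq> q y" using q[of y] e_W xyzw_e(2) ep(9) by auto
  ultimately show False by auto
qed

text \<open>The type and the counts are governed by the same data. The pairing fixes the vertex
  numbers before and after contraction and, for loops, orientability; whether \<open>x\<close> and
  \<open>z\<close> share a vertex colour, or \<open>x\<close> and \<open>y\<close> a boundary
  colour, settles the rest.\<close>

lemma one_edge_type: "\<exists>t. is_one_edge_graph t (remove_isolated H) \<and> step t (state H {}) (state H {e})"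
proof -
  have H'v: "verts H' = {conn Rv `` {x}, conn Rv `` {z}}"
    and H'b: "bounds H' = {conn Rb `` {x}, conn Rb `` {y}}"
    unfolding H'_curves using W_verts W_bounds by auto
  have vP: "conn Rv `` {x} \<in> verts H" "conn Rv `` {z} \<in> verts H"
    "conn Rb `` {x} \<in> bounds H" "conn Rb `` {y} \<in> bounds H"
    using xyzw_P by (simp_all add: verts_H bounds_H quotientI)
  have inV: "(a, b) \<in> conn (crel (vcol H))" if "(a, b) \<in> conn R0" for a b
    using that in_Rv(3) Rv_vcol by blast
  have inB: "(a, b) \<in> conn (crel (bcol H))" if "(a, b) \<in> conn R0" for a b
    using that in_Rb(3) Rb_bcol by blast
  have "\<exists>t. is_one_edge_graph t H' \<and> step t (state H {}) (state H {e})"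
  proof (cases rule: pairing)
    case 1
    have "conn Rv = conn R0"
      using 1 by (simp add: Rv_eq conn_insert_redundant conn_insertI)
    then have ne: "conn Rv `` {x} \<noteq> conn Rv `` {z}" using 1(3) by (simp add: conn_class_eq_iff)
    \<comment> \<open>Paths join \<open>x\<close> to \<open>y\<close> and \<open>z\<close> to
      \<open>w\<close>, so one side makes the other redundant: contraction puts one vertex in place
      of two.\<close>
    have yw: "(y, w) \<in> conn (insert (x, z) R0)"
      using conn_insertI[OF 1(1)] conn_insertI[OF 1(2)] conn_incl[of x z "insert (x, z) R0"]
        conn_sym conn_trans by (metis insertI1)
    have "vnum H {} = card (P // conn R0)"
      using \<open>conn Rv = conn R0\<close> by (simp add: vnum_H Rv_eq)
    moreover have "vnum H {e} = card (P // conn (insert (x, z) R0))"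
      unfolding vnum_H by (subst insert_commute) (simp only: conn_insert_redundant[OF yw])
    ultimately have v: "vnum H {} = vnum H {e} + 1"
      using card_insert[OF xyzw_P(1,3), of R0] 1(3) by simp
    have m: "bcnum H {} = bcnum H {e}"
      using inB[OF 1(1)] by (simp add: bcnum_H conn_insert_redundant)
    have meet: "conn Rv `` {x} \<inter> e \<noteq> {}" "conn Rv `` {z} \<inter> e \<noteq> {}"
      using xyzw_e conn_refl[of x Rv] conn_refl[of z Rv] by blast+
    have vc: "vcol H' = (if (x, z) \<in> conn (crel (vcol H))
        then {{conn Rv `` {x}, conn Rv `` {z}}} else {{conn Rv `` {x}}, {conn Rv `` {z}}})"
      unfolding H'_simps W_vcol partition_restrict_pair[OF coloured_ribbon_graphD(2)[OF H] vP(1,2) ne]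
        same_vcol[OF xyzw_P(1,3)] ..
    show ?thesis
    proof (cases "(x, z) \<in> conn (crel (vcol H))")
      case True
      then have "vcnum H {} = vcnum H {e}" by (simp add: vcnum_H conn_insert_redundant)
      moreover have "vcol H' = {{conn Rv `` {x}, conn Rv `` {z}}}" using True vc by (simp only: if_True)
      then have "is_one_edge_graph bp H'"
        unfolding is_one_edge_graph.simps
        by (intro exI[of _ e] exI[of _ "conn Rv `` {x}"] exI[of _ "conn Rv `` {z}"] conjI H'_edges H'v ne meet)
      ultimately show ?thesis using v m by (intro exI[of _ bp]) (simp add: state_def)
    next
      case False
      then have "vcnum H {} = vcnum H {e} + 1"
        using card_insert[OF xyzw_P(1,3), of "crel (vcol H)"] by (simp add: vcnum_H)
      moreover have "vcol H' = {{conn Rv `` {x}}, {conn Rv `` {z}}}" using False vc by (simp only: if_False)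
      then have "is_one_edge_graph bs H'"
        unfolding is_one_edge_graph.simps
        by (intro exI[of _ e] exI[of _ "conn Rv `` {x}"] exI[of _ "conn Rv `` {z}"] conjI H'_edges H'v ne meet)
      ultimately show ?thesis using v m by (intro exI[of _ bs]) (simp add: state_def)
    qed
  next
    case 2
    have "conn Rb = conn R0"
      using 2 by (simp add: Rb_eq conn_insert_redundant conn_insertI)
    then have ne: "conn Rb `` {x} \<noteq> conn Rb `` {y}" using 2(3) by (simp add: conn_class_eq_iff)
    \<comment> \<open>Dually, one segment makes the other redundant: there is one vertex at
      \<open>e\<close>, but two boundary components, which become vertices under
      contraction.\<close>
    have zw: "(z, w) \<in> conn (insert (x, y) R0)"
      using conn_insertI[OF 2(1)] conn_insertI[OF 2(2)] conn_incl[of x y "insert (x, y) R0"]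
        conn_sym conn_trans by (metis insertI1)
    have "vnum H {e} = card (P // conn R0)"
      using \<open>conn Rb = conn R0\<close> by (simp add: vnum_H Rb_eq)
    moreover have "vnum H {} = card (P // conn (insert (x, y) R0))"
      unfolding vnum_H by (subst insert_commute) (simp only: conn_insert_redundant[OF zw])
    ultimately have v: "vnum H {e} = vnum H {} + 1"
      using card_insert[OF xyzw_P(1,2), of R0] 2(3) by simp
    have n: "vcnum H {} = vcnum H {e}"
      using inV[OF 2(1)] by (simp add: vcnum_H conn_insert_redundant)
    have "conn Rv `` {x} = conn Rv `` {z}"
      using 2(1) in_Rv(3) by (auto simp: conn_class_eq_iff)
    then have vH': "verts H' = {conn Rv `` {x}}" using H'v by simp
    note or = orientable_H'[OF 2]
    have bc: "bcol H' = (if (x, y) \<in> conn (crel (bcol H))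
        then {{conn Rb `` {x}, conn Rb `` {y}}} else {{conn Rb `` {x}}, {conn Rb `` {y}}})"
      unfolding H'_simps W_bcol partition_restrict_pair[OF coloured_ribbon_graphD(3)[OF H] vP(3,4) ne]
        same_bcol[OF xyzw_P(1,2)] ..
    show ?thesis
    proof (cases "(x, y) \<in> conn (crel (bcol H))")
      case True
      then have "bcnum H {e} = bcnum H {}" by (simp add: bcnum_H conn_insert_redundant)
      moreover have "bcol H' = {{conn Rb `` {x}, conn Rb `` {y}}}" using True bc by (simp only: if_True)
      then have "is_one_edge_graph olh H'"
        unfolding is_one_edge_graph.simps
        by (intro exI[of _ e] exI[of _ "conn Rv `` {x}"] exI[of _ "conn Rb `` {x}"] exI[of _ "conn Rb `` {y}"] conjI
            H'_edges H'b vH' ne or)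
      ultimately show ?thesis using v n by (intro exI[of _ olh]) (simp add: state_def)
    next
      case False
      then have "bcnum H {e} = bcnum H {} + 1"
        using card_insert[OF xyzw_P(1,2), of "crel (bcol H)"] by (simp add: bcnum_H)
      moreover have "bcol H' = {{conn Rb `` {x}}, {conn Rb `` {y}}}" using False bc by (simp only: if_False)
      then have "is_one_edge_graph olc H'"
        unfolding is_one_edge_graph.simps
        by (intro exI[of _ e] exI[of _ "conn Rv `` {x}"] exI[of _ "conn Rb `` {x}"] exI[of _ "conn Rb `` {y}"] conjI
            H'_edges H'b vH' ne or)
      ultimately show ?thesis using v n by (intro exI[of _ olc]) (simp add: state_def)
    qed
  next
    case 3
    \<comment> \<open>With diagonal paths a single segment or a single side already joins all four
      points. Both vertex counts are one below the class count of \<open>R0\<close>, hence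
      equal.\<close>
    have xz: "(x, z) \<in> conn (insert (x, y) R0)"
      using conn_insertI[OF 3(2)] conn_incl[of x y "insert (x, y) R0"] conn_trans by (metis insertI1)
    have zw: "(z, w) \<in> conn (insert (x, y) R0)"
      using xz conn_insertI[OF 3(1)] conn_sym conn_trans by metis
    have yw: "(y, w) \<in> conn (insert (x, z) R0)"
      using conn_insertI[OF 3(1)] conn_insertI[OF 3(2)] conn_incl[of x z "insert (x, z) R0"]
        conn_sym conn_trans by (metis insertI1)
    have "vnum H {} = card (P // conn (insert (x, y) R0))"
      unfolding vnum_H by (subst insert_commute) (simp only: conn_insert_redundant[OF zw])
    moreover have "vnum H {e} = card (P // conn (insert (x, z) R0))"
      unfolding vnum_H by (subst insert_commute) (simp only: conn_insert_redundant[OF yw])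
    ultimately have v: "vnum H {e} = vnum H {}"
      using card_insert[OF xyzw_P(1,2), of R0] card_insert[OF xyzw_P(1,3), of R0] 3(3,4) by simp
    have "(x, z) \<in> conn Rv"
      using conn_trans[OF in_Rv(1)] in_Rv(3) 3(2) by blast
    then have vH': "verts H' = {conn Rv `` {x}}" and xz: "(x, z) \<in> conn (crel (vcol H))"
      using H'v Rv_vcol conn_class_eq_iff[of Rv x z] by auto
    have "(x, y) \<in> conn Rb"
      using conn_trans[OF in_Rb(1)] in_Rb(3) conn_sym[OF 3(2)] by blast
    then have xy: "(x, y) \<in> conn (crel (bcol H))" using Rb_bcol by blast
    have "is_one_edge_graph nl H'"
      using H'_edges vH' not_orientable_H'[OF 3(1)] by auto
    moreover have "vcnum H {} = vcnum H {e}" "bcnum H {} = bcnum H {e}"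
      using xz xy by (simp_all add: vcnum_H bcnum_H conn_insert_redundant)
    ultimately show ?thesis using v by (intro exI[of _ nl]) (simp add: state_def)
  qed
  then show ?thesis by (simp only: H'_def)
qed

end


section \<open>States of minors and edge types\<close>

lemma state_contract:
  assumes "coloured_ribbon_graph G" "e \<in> edges G"
  shows "state (contract e G) A = state G (insert e A)"
  using assms by (simp add: state_def vnum_contract vcnum_contract bcnum_contract)

lemma state_delete:
  assumes "coloured_ribbon_graph G" "e \<in> edges G" "A \<subseteq> edges G - {e}"
  shows "state (delete e G) A = state G A"
  using assms by (simp add: state_def vnum_delete vcnum_delete bcnum_delete)

text \<open>The right-hand sides mention only \<open>set es\<close>. This is the form in which order
  independence is used: the states of the resulting graphs are compared, not the graphs.\<close>

lemma fold_contract: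
  assumes "coloured_ribbon_graph G" "distinct es" "set es \<subseteq> edges G"
  shows "coloured_ribbon_graph (fold contract es G) \<and> edges (fold contract es G) = edges G - set es \<and>
    (\<forall>A. state (fold contract es G) A = state G (A \<union> set es))"
  using assms
proof (induction es arbitrary: G)
  case (Cons e es)
  have G': "coloured_ribbon_graph (contract e G)" "edges (contract e G) = edges G - {e}"
    using Cons.prems by (auto intro: coloured_ribbon_graph_contract simp: edges_contract)
  then have "coloured_ribbon_graph (fold contract es (contract e G)) \<and>
      edges (fold contract es (contract e G)) = edges G - {e} - set es \<and>
      (\<forall>A. state (fold contract es (contract e G)) A = state (contract e G) (A \<union> set es))"
    using Cons.IH[of "contract e G"] Cons.prems by auto
  moreover have "edges G - {e} - set es = edges G - set (e # es)" by auto
  ultimately show ?case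
    using Cons.prems by (simp add: state_contract)
qed simp

lemma fold_delete:
  assumes "coloured_ribbon_graph G" "distinct es" "set es \<subseteq> edges G"
  shows "coloured_ribbon_graph (fold delete es G) \<and> edges (fold delete es G) = edges G - set es \<and>
    (\<forall>A. A \<subseteq> edges G - set es \<longrightarrow> state (fold delete es G) A = state G A)"
  using assms
proof (induction es arbitrary: G)
  case (Cons e es)
  have G': "coloured_ribbon_graph (delete e G)" "edges (delete e G) = edges G - {e}"
    using Cons.prems by (auto intro: coloured_ribbon_graph_delete simp: edges_delete)
  then have IH: "coloured_ribbon_graph (fold delete es (delete e G))"
      "edges (fold delete es (delete e G)) = edges G - {e} - set es"
      "\<And>A. A \<subseteq> edges G - {e} - set es \<Longrightarrow> state (fold delete es (delete e G)) A = state (delete e G) A"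
    using Cons.IH[OF G'(1)] Cons.prems unfolding G'(2) by (simp_all add: subset_Diff_insert)
  have *: "edges G - {e} - set es = edges G - set (e # es)" by auto
  have "state (fold delete es (delete e G)) A = state G A" if "A \<subseteq> edges G - set (e # es)" for A
    using IH(3)[unfolded *, OF that] state_delete[of G e A] Cons.prems that by auto
  then show ?case
    using IH(1,2) unfolding * by simp
qed simp

lemma contracts_to_type:
  assumes G: "coloured_ribbon_graph G" and e: "e \<in> edges G" and H: "contracts_to G (edges G - {e}) H"
  shows "\<exists>t. is_one_edge_graph t (remove_isolated H) \<and>
    step t (state G (edges G - {e})) (state G (edges G))"
proof -
  obtain es where es: "distinct es" "set es = edges G - {e}" "H = fold contract es G"
    using H by (auto simp: contracts_to_def)
  have H': "coloured_ribbon_graph H" "edges H = edges G - (edges G - {e})"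
    "\<And>A. state H A = state G (A \<union> (edges G - {e}))"
    using fold_contract[OF G es(1)] es by auto
  have E: "edges H = {e}" "{e} \<union> (edges G - {e}) = edges G" using H'(2) e by auto
  obtain x where "x \<in> e" using edge_nonempty[OF coloured_ribbon_graphD(1)[OF G] e] by blast
  from one_edge_type[OF H'(1) E(1) this] show ?thesis
    unfolding H'(3) E(2) by simp
qed

lemma deletes_to_type:
  assumes G: "coloured_ribbon_graph G" and e: "e \<in> edges G" and H: "deletes_to G (edges G - {e}) H"
  shows "\<exists>t. is_one_edge_graph t (remove_isolated H) \<and> step t (state G {}) (state G {e})"
proof -
  obtain es where es: "distinct es" "set es = edges G - {e}" "H = fold delete es G"
    using H by (auto simp: deletes_to_def)
  have "edges G - (edges G - {e}) = {e}" using e by auto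
  then have H': "coloured_ribbon_graph H" "edges H = {e}"
    "\<And>A. A \<subseteq> {e} \<Longrightarrow> state H A = state G A"
    using fold_delete[OF G es(1)] es by auto
  obtain x where "x \<in> e" using edge_nonempty[OF coloured_ribbon_graphD(1)[OF G] e] by blast
  from one_edge_type[OF H'(1,2) this] show ?thesis
    by (simp add: H'(3))
qed

text \<open>Numbers of vertices and colour classes, together with orientability, tell the five
  graphs apart. Hence a type asserted by \<open>has_type\<close> is the one for which a
  \<open>step\<close> was found.\<close>

lemma is_one_edge_graph_unique:
  assumes "is_one_edge_graph t G" "is_one_edge_graph t' G"
  shows "t = t'"
proof -
  let ?inv = "\<lambda>t. case t of
      bs \<Rightarrow> card (verts G) = 2 \<and> card (vcol G) = 2
    | bp \<Rightarrow> card (verts G) = 2 \<and> card (vcol G) = 1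
    | olc \<Rightarrow> card (verts G) = 1 \<and> orientable G \<and> card (bcol G) = 2
    | olh \<Rightarrow> card (verts G) = 1 \<and> orientable G \<and> card (bcol G) = 1
    | nl \<Rightarrow> card (verts G) = 1 \<and> \<not> orientable G"
  have "?inv t" if "is_one_edge_graph t G" for t
    using that
    by (cases t; simp only: is_one_edge_graph.simps edge_type.case; elim exE conjE; simp)
  from this[OF assms(1)] this[OF assms(2)] show ?thesis
    by (cases t; cases t') auto
qed

lemma has_type_step:
  assumes G: "coloured_ribbon_graph G" and t: "has_type G e (i, j)"
  shows "e \<in> edges G" "step i (state G (edges G - {e})) (state G (edges G))"
    "step j (state G {}) (state G {e})"
proof -
  obtain H H' where H: "contracts_to G (edges G - {e}) H" "is_one_edge_graph i (remove_isolated H)"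
    and H': "deletes_to G (edges G - {e}) H'" "is_one_edge_graph j (remove_isolated H')"
    and e: "e \<in> edges G"
    using t unfolding has_type_def by auto
  show "e \<in> edges G" by fact
  show "step i (state G (edges G - {e})) (state G (edges G))"
    using contracts_to_type[OF G e H(1)] is_one_edge_graph_unique[OF H(2)] by blast
  show "step j (state G {}) (state G {e})"
    using deletes_to_type[OF G e H'(1)] is_one_edge_graph_unique[OF H'(2)] by blast
qed

text \<open>The other edges can be listed in some order, so the recursion never gets stuck at an
  edge without a type.\<close>

lemma has_type_exists:
  assumes G: "coloured_ribbon_graph G" and e: "e \<in> edges G"
  shows "\<exists>i j. has_type G e (i, j)"
proof -
  have "finite (edges G - {e})" using finite_edges[OF coloured_ribbon_graphD(1)[OF G]] by simp
  from finite_distinct_list[OF this]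
  obtain es where "set es = edges G - {e}" "distinct es" by blast
  then have "contracts_to G (edges G - {e}) (fold contract es G)"
    "deletes_to G (edges G - {e}) (fold delete es G)"
    by (auto simp: contracts_to_def deletes_to_def)
  then show ?thesis
    using contracts_to_type[OF assms] deletes_to_type[OF assms] e unfolding has_type_def prod.case
    by blast
qed

text \<open>Contract \<open>A\<close> first and then delete everything but \<open>e\<close>: in the
  contracted graph, \<open>{}\<close> and \<open>{e}\<close> have the states of \<open>A\<close> and
  \<open>insert e A\<close>.\<close>

lemma state_step:
  assumes G: "coloured_ribbon_graph G" and A: "A \<subseteq> edges G" and e: "e \<in> edges G - A"
  shows "\<exists>t. step t (state G A) (state G (insert e A))"
proof -
  have fin: "finite (edges G)" using finite_edges coloured_ribbon_graphD(1)[OF G] by blast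
  obtain es where es: "distinct es" "set es = A"
    using finite_distinct_list[OF finite_subset[OF A fin]] by blast
  define G1 where "G1 = fold contract es G"
  have G1: "coloured_ribbon_graph G1" "edges G1 = edges G - A" "\<And>B. state G1 B = state G (B \<union> A)"
    using fold_contract[OF G es(1)] es(2) A by (auto simp: G1_def)
  obtain ds where ds: "distinct ds" "set ds = edges G1 - {e}"
    using finite_distinct_list[of "edges G1 - {e}"] fin G1(2) by auto
  then have "deletes_to G1 (edges G1 - {e}) (fold delete ds G1)" by (auto simp: deletes_to_def)
  then have "\<exists>t. step t (state G1 {}) (state G1 {e})"
    using deletes_to_type[OF G1(1)] e G1(2) by blast
  then show ?thesis by (simp add: G1(3))
qed

section \<open>Weights\<close>

text \<open>
  Among \<open>k\<close> steps between two states, \<open>n - n'\<close> are of type \<open>bs\<close>, \<open>m' - m\<close> of type \<open>olc\<close>, and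
  \<open>v - v'\<close> is the number of \<open>bs\<close> and \<open>bp\<close> minus that of \<open>olc\<close> and \<open>olh\<close>. The exponents of
  \<open>r\<close> and \<open>s\<close> are therefore twice the number of \<open>bp\<close> (of \<open>olh\<close>) plus that of \<open>nl\<close>. Under \<open>reach k\<close>
  no subtraction in \<open>weight\<close> truncates.
\<close>

fun reach :: "nat \<Rightarrow> nat \<times> nat \<times> nat \<Rightarrow> nat \<times> nat \<times> nat \<Rightarrow> bool" where
  "reach k (v, n, m) (v', n', m') \<longleftrightarrow>
     n' \<le> n \<and> m \<le> m' \<and> 2 * n + v' \<le> k + v + 2 * n' \<and> 2 * m' + v \<le> k + v' + 2 * m"

fun weight :: "'r \<Rightarrow> 'r \<Rightarrow> 'r \<Rightarrow> 'r \<Rightarrow> nat \<Rightarrow> nat \<times> nat \<times> nat \<Rightarrow> nat \<times> nat \<times> nat \<Rightarrow> 'r::comm_semiring_1" where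
  "weight p q r s k (v, n, m) (v', n', m') =
     p ^ (n - n') * q ^ (m' - m) * r ^ (k + v + 2 * n' - (2 * n + v')) * s ^ (k + v' + 2 * m - (2 * m' + v))"

lemma reach_refl: "reach 0 a a"
  by (cases a) simp

lemma reach_trans: "reach k a b \<Longrightarrow> reach l b c \<Longrightarrow> reach (k + l) a c"
  by (cases a; cases b; cases c) simp

lemma step_reach: "step t a b \<Longrightarrow> reach 1 a b"
  by (cases t; cases a; cases b) auto

lemma weight_refl: "weight p q r s 0 a a = 1"
  by (cases a) simp

lemma weight_trans:
  assumes "reach k a b" "reach l b c"
  shows "weight p q r s (k + l) a c = weight p q r s k a b * weight p q r s l b c"
proof -
  obtain v n m v' n' m' v'' n'' m'' where s: "a = (v, n, m)" "b = (v', n', m')" "c = (v'', n'', m'')"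
    by (metis prod.collapse)
  have eqs: "n - n'' = (n - n') + (n' - n'')" "m'' - m = (m' - m) + (m'' - m')"
    "k + l + v + 2 * n'' - (2 * n + v'') =
      (k + v + 2 * n' - (2 * n + v')) + (l + v' + 2 * n'' - (2 * n' + v''))"
    "k + l + v'' + 2 * m - (2 * m'' + v) =
      (k + v' + 2 * m - (2 * m' + v)) + (l + v'' + 2 * m' - (2 * m'' + v'))"
    using assms unfolding s by auto
  show ?thesis unfolding s weight.simps eqs power_add by (simp only: mult_ac)
qed

definition aweight :: "nat \<Rightarrow> nat \<times> nat \<times> nat \<Rightarrow> nat \<times> nat \<times> nat \<Rightarrow> upoly" where
  "aweight = weight (X A_bs) (X A_olc) (X A_bp_half) (X A_olh_half)"

definition bweight :: "nat \<Rightarrow> nat \<times> nat \<times> nat \<Rightarrow> nat \<times> nat \<times> nat \<Rightarrow> upoly" where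
  "bweight = weight (X B_bs) (X B_olc) (X B_bp_half) (X B_olh_half)"

text \<open>For one step the exponents of the third and fourth variables are 2 and 0 for
  \<open>bp\<close>, 0 and 2 for \<open>olh\<close>, 1 and 1 for \<open>nl\<close>, and 0 otherwise;
  the half-power indeterminates are substituted for these variables.\<close>

lemma step_weight:
  assumes "step t a b"
  shows "aweight 1 a b = coeff_a t" "bweight 1 a b = coeff_b t"
  using assms by (cases t; cases a; cases b; auto simp: aweight_def bweight_def power2_eq_square)+

text \<open>Adding \<open>D\<close> edge by edge gives a chain of \<open>card D\<close> steps; the
  choice of chain leaves no trace in \<open>reach\<close>.\<close>

lemma state_reach:
  assumes G: "coloured_ribbon_graph G" and "finite D" "A \<inter> D = {}" "A \<union> D \<subseteq> edges G"
  shows "reach (card D) (state G A) (state G (A \<union> D))"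
  using assms(2-)
proof (induction D)
  case empty
  show ?case by (simp add: reach_refl)
next
  case (insert e D)
  have "\<exists>t. step t (state G (A \<union> D)) (state G (insert e (A \<union> D)))"
    using insert by (intro state_step[OF G]) auto
  then have "reach 1 (state G (A \<union> D)) (state G (insert e (A \<union> D)))"
    using step_reach by blast
  then have "reach (card D + 1) (state G A) (state G (A \<union> insert e D))"
    unfolding Un_insert_right using insert by (intro reach_trans[of _ _ "state G (A \<union> D)"]) auto
  then show ?case using insert by simp
qed

section \<open>The state sum\<close>

fun value_of :: "nat \<times> nat \<times> nat \<Rightarrow> upoly" where
  "value_of (v, n, m) = X Alpha ^ n * X Beta ^ m * X Gamma ^ v"

definition term_of :: "'a coloured_ribbon \<Rightarrow> 'a set set \<Rightarrow> upoly" where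
  "term_of G A = value_of (state G A) * bweight (card A) (state G {}) (state G A) *
     aweight (card (edges G - A)) (state G A) (state G (edges G))"

definition U_poly :: "'a coloured_ribbon \<Rightarrow> upoly" where
  "U_poly G = (\<Sum>A\<in>Pow (edges G). term_of G A)"

lemma U_poly_edgeless:
  assumes "coloured_ribbon_graph G" "edges G = {}"
  shows "U_poly G = X Alpha ^ card (vcol G) * X Beta ^ card (bcol G) * X Gamma ^ card (verts G)"
  using vnum_empty[OF assms(1)] vcnum_empty[OF assms(1)] bcnum_edges[OF assms(1)]
  by (simp add: U_poly_def term_of_def state_def assms(2) weight_refl aweight_def bweight_def)

text \<open>If \<open>e\<close> is deleted, the chain from \<open>A\<close> to all edges may be
  taken to add \<open>e\<close> last, and its last step has the type of \<open>e\<close> after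
  contracting the rest; this splits off \<open>coeff_a i\<close>. If \<open>e\<close> is contracted,
  the chain from the empty set may add \<open>e\<close> first, which splits off
  \<open>coeff_b j\<close>.\<close>

lemma
  assumes G: "coloured_ribbon_graph G" and e: "e \<in> edges G" and A: "A \<subseteq> edges G - {e}"
  shows term_of_delete: "step i (state G (edges G - {e})) (state G (edges G)) \<Longrightarrow>
      term_of G A = coeff_a i * term_of (delete e G) A"
    and term_of_contract: "step j (state G {}) (state G {e}) \<Longrightarrow>
      term_of G (insert e A) = coeff_b j * term_of (contract e G) A"
proof -
  have fin: "finite (edges G)" using finite_edges coloured_ribbon_graphD(1)[OF G] by blast
  have finA: "finite A" using A fin finite_subset by blast
  let ?E = "edges G - {e}"
  show "term_of G A = coeff_a i * term_of (delete e G) A"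
    if i: "step i (state G ?E) (state G (edges G))"
  proof -
    have "reach (card (?E - A)) (state G A) (state G (A \<union> (?E - A)))"
      using A fin by (intro state_reach[OF G]) auto
    moreover have "A \<union> (?E - A) = ?E" using A by blast
    ultimately have "aweight (card (?E - A) + 1) (state G A) (state G (edges G)) =
        aweight (card (?E - A)) (state G A) (state G ?E) * coeff_a i"
      using weight_trans[OF _ step_reach[OF i]] step_weight(1)[OF i] unfolding aweight_def by metis
    moreover have "edges G - A = insert e (?E - A)" using e A by blast
    then have "card (edges G - A) = card (?E - A) + 1" using fin by simp
    ultimately show ?thesis
      using state_delete[OF G e] A by (simp add: term_of_def edges_delete[OF G e] ac_simps)
  qed
  show "term_of G (insert e A) = coeff_b j * term_of (contract e G) A"
    if j: "step j (state G {}) (state G {e})"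
  proof -
    have "reach (card A) (state G {e}) (state G ({e} \<union> A))"
      using A e finA by (intro state_reach[OF G]) auto
    then have r: "reach (card A) (state G {e}) (state G (insert e A))" by simp
    have "bweight (1 + card A) (state G {}) (state G (insert e A)) =
        coeff_b j * bweight (card A) (state G {e}) (state G (insert e A))"
      using step_weight(2)[OF j] unfolding bweight_def
      by (simp only: weight_trans[OF step_reach[OF j] r])
    moreover have "card (insert e A) = 1 + card A" using A finA by (subst card_insert_disjoint) auto
    moreover have "edges G - insert e A = ?E - A" "insert e ?E = edges G" using e by auto
    ultimately show ?thesis
      using state_contract[OF G e] by (simp add: term_of_def edges_contract[OF G e] ac_simps)
  qed
qed

lemma U_poly_recursion:
  assumes G: "coloured_ribbon_graph G" and t: "has_type G e (i, j)"
  shows "U_poly G = coeff_a i * U_poly (delete e G) + coeff_b j * U_poly (contract e G)"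
proof -
  note e = has_type_step(1)[OF assms] and st = has_type_step(2,3)[OF assms]
  let ?E = "edges G - {e}"
  have fin: "finite ?E" using finite_edges coloured_ribbon_graphD(1)[OF G] by blast
  have "Pow (edges G) = Pow ?E \<union> insert e ` Pow ?E"
    using Pow_insert[of e ?E] e by (simp add: insert_absorb)
  moreover have "inj_on (insert e) (Pow ?E)" by (auto simp: inj_on_def)
  moreover have "Pow ?E \<inter> insert e ` Pow ?E = {}" by auto
  ultimately have "U_poly G = (\<Sum>A\<in>Pow ?E. term_of G A) + (\<Sum>A\<in>Pow ?E. term_of G (insert e A))"
    using fin by (simp add: U_poly_def sum.union_disjoint sum.reindex)
  also have "(\<Sum>A\<in>Pow ?E. term_of G A) = coeff_a i * U_poly (delete e G)"
    unfolding U_poly_def edges_delete[OF G e] sum_distrib_left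
    using term_of_delete[OF G e _ st(1)] by (intro sum.cong) auto
  also have "(\<Sum>A\<in>Pow ?E. term_of G (insert e A)) = coeff_b j * U_poly (contract e G)"
    unfolding U_poly_def edges_contract[OF G e] sum_distrib_left
    using term_of_contract[OF G e _ st(2)] by (intro sum.cong) auto
  finally show ?thesis .
qed

lemma evaluates_U_poly:
  assumes "coloured_ribbon_graph G"
  shows "evaluates G (U_poly G)"
  using assms
proof (induction "card (edges G)" arbitrary: G)
  case 0
  then have E: "edges G = {}" using finite_edges coloured_ribbon_graphD(1) by (metis card_0_eq)
  then show ?case
    using evaluates.edgeless[OF E] U_poly_edgeless[OF 0(2) E] by (simp add: edgeless_value_def)
next
  case (Suc k)
  then obtain e where e: "e \<in> edges G" by (metis card.empty equals0I nat.distinct(1))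
  obtain i j where t: "has_type G e (i, j)" using has_type_exists[OF Suc.prems e] by blast
  have k: "card (edges G - {e}) = k" using Suc.hyps(2) e by simp
  show ?case
    unfolding U_poly_recursion[OF Suc.prems t]
  proof (rule evaluates.recurse[OF t])
    show "evaluates (delete e G) (U_poly (delete e G))"
      using coloured_ribbon_graph_delete[OF Suc.prems e] k
      by (intro Suc.hyps(1)) (simp_all add: edges_delete[OF Suc.prems e])
    show "evaluates (contract e G) (U_poly (contract e G))"
      using coloured_ribbon_graph_contract[OF Suc.prems e] k
      by (intro Suc.hyps(1)) (simp_all add: edges_contract[OF Suc.prems e])
  qed
qed

text \<open>By induction over the run: whichever edge is chosen, \<open>U_poly\<close> obeys the
  recursion there, so the result carries no memory of the choices.\<close>

lemma evaluates_unique: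
  assumes "evaluates G p" "coloured_ribbon_graph G"
  shows "p = U_poly G"
  using assms
proof (induction rule: evaluates.induct)
  case (edgeless G)
  then show ?case by (simp add: U_poly_edgeless edgeless_value_def)
next
  case (recurse G e i j p q)
  have e: "e \<in> edges G" using has_type_step(1)[OF recurse.prems recurse.hyps(1)] .
  show ?case
    using recurse.IH coloured_ribbon_graph_delete[OF recurse.prems e]
      coloured_ribbon_graph_contract[OF recurse.prems e]
      U_poly_recursion[OF recurse.prems recurse.hyps(1)] by simp
qed


section \<open>Invariance under equivalence\<close>

text \<open>The state sum sees a graph only through the map from edge sets to states.\<close>

lemma U_poly_cong:
  assumes "bij_betw \<phi> (edges G) (edges H)" "finite (edges G)"
    and st: "\<And>A. A \<subseteq> edges G \<Longrightarrow> state H (\<phi> ` A) = state G A"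
  shows "U_poly H = U_poly G"
proof -
  have inj: "inj_on \<phi> (edges G)" and im: "\<phi> ` edges G = edges H"
    using assms(1) by (auto simp: bij_betw_def)
  have "term_of H (\<phi> ` A) = term_of G A" if A: "A \<subseteq> edges G" for A
  proof -
    have "edges H - \<phi> ` A = \<phi> ` (edges G - A)"
      using inj_on_image_set_diff[OF inj _ A, of "edges G"] im by simp
    then have "card (edges H - \<phi> ` A) = card (edges G - A)" "card (\<phi> ` A) = card A"
      using A inj by (simp_all add: card_image inj_on_subset)
    moreover have "state H {} = state G {}" "state H (edges H) = state G (edges G)"
      using st[of "{}"] st[of "edges G"] im by simp_all
    ultimately show ?thesis by (simp add: term_of_def st[OF A])
  qed
  moreover have "Pow (edges H) = image \<phi> ` Pow (edges G)"
    using im by (metis image_Pow_surj)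
  moreover have "inj_on (image \<phi>) (Pow (edges G))"
    using inj by (rule inj_on_image_Pow)
  ultimately show ?thesis by (simp add: U_poly_def sum.reindex)
qed

lemma crel_image: "crel ((\<lambda>c. (\<lambda>v. h ` v) ` c) ` K) = map_prod h h ` crel K"
  unfolding crel_def by (auto simp: image_iff)

lemma state_relations_subset:
  assumes G: "coloured_ribbon_graph G" and A: "A \<subseteq> edges G"
  shows "gr (pts G) (arc G) \<union> gr (pts G) (\<lambda>x. if x \<in> \<Union>A then side G x else seg G x) \<subseteq> pts G \<times> pts G"
    and "crel (vcol G) \<union> clq A \<subseteq> pts G \<times> pts G"
    and "crel (bcol G) \<union> clq (edges G - A) \<subseteq> pts G \<times> pts G"
proof -
  note cG = coloured_ribbon_graphD[OF G]
  have clq: "clq B \<subseteq> pts G \<times> pts G" if "B \<subseteq> edges G" for B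
    using that edge_subset[OF cG(1)] by (auto simp: clq_def)
  show "gr (pts G) (arc G) \<union> gr (pts G) (\<lambda>x. if x \<in> \<Union>A then side G x else seg G x) \<subseteq> pts G \<times> pts G"
    using fpf_involution_onD(1)[OF ribbon_graphD(2)[OF cG(1)]]
      fpf_involution_onD(1)[OF ribbon_graphD(3)[OF cG(1)]]
      fpf_involution_onD(1)[OF ribbon_graphD(4)[OF cG(1)]] by auto
  show "crel (vcol G) \<union> clq A \<subseteq> pts G \<times> pts G"
    using crel_subset[OF cG(4,2)] clq[OF A] by blast
  show "crel (bcol G) \<union> clq (edges G - A) \<subseteq> pts G \<times> pts G"
    using crel_subset[OF cG(5,3)] clq[of "edges G - A"] by blast
qed

lemma U_poly_isomorphic:
  assumes G: "coloured_ribbon_graph G" and H: "coloured_ribbon_graph H" and iso: "isomorphic G H"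
  shows "U_poly H = U_poly G"
proof -
  note rG = coloured_ribbon_graphD(1)[OF G] and rH = coloured_ribbon_graphD(1)[OF H]
  obtain h where h: "bij_betw h (pts G) (pts H) \<and>
      (\<forall>x\<in>pts G. h (arc G x) = arc H (h x) \<and> h (seg G x) = seg H (h x) \<and>
        h (side G x) = side H (h x)) \<and>
      vcol H = (\<lambda>c. (\<lambda>v. h ` v) ` c) ` vcol G \<and> bcol H = (\<lambda>c. (\<lambda>v. h ` v) ` c) ` bcol G"
    using iso[unfolded isomorphic_def] by (rule exE)
  note bij = h[THEN conjunct1] and hom = h[THEN conjunct2, THEN conjunct1, THEN bspec]
    and col = h[THEN conjunct2, THEN conjunct2, THEN conjunct1]
      h[THEN conjunct2, THEN conjunct2, THEN conjunct2]
  have inj: "inj_on h (pts G)" and im: "h ` pts G = pts H" using bij by (auto simp: bij_betw_def)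
  note segP = fpf_involution_onD(1)[OF ribbon_graphD(3)[OF rG]]
  note sideP = fpf_involution_onD(1)[OF ribbon_graphD(4)[OF rG]]
  have edges: "edges H = (\<lambda>e. h ` e) ` edges G"
  proof -
    have pt: "{h x, seg H (h x), side H (h x), seg H (side H (h x))} =
        h ` {x, seg G x, side G x, seg G (side G x)}" if "x \<in> pts G" for x
      using hom[OF that] hom[OF sideP[OF that]] by simp
    have ne: "seg H (h x) \<noteq> side H (h x) \<longleftrightarrow> seg G x \<noteq> side G x" if "x \<in> pts G" for x
      using hom[OF that] inj_onD[OF inj, of "seg G x" "side G x"] segP[OF that] sideP[OF that] by metis
    have "edges H = (\<lambda>x. {h x, seg H (h x), side H (h x), seg H (side H (h x))}) `
        {x \<in> pts G. seg H (h x) \<noteq> side H (h x)}"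
      unfolding edges_def im[symmetric] by auto
    also have "\<dots> = (\<lambda>x. h ` {x, seg G x, side G x, seg G (side G x)}) `
        {x \<in> pts G. seg G x \<noteq> side G x}"
      using pt ne by (intro image_cong) auto
    finally have "edges H = (\<lambda>x. h ` {x, seg G x, side G x, seg G (side G x)}) `
        {x \<in> pts G. seg G x \<noteq> side G x}" .
    moreover have "edges G = (\<lambda>x. {x, seg G x, side G x, seg G (side G x)}) `
        {x \<in> pts G. seg G x \<noteq> side G x}"
      unfolding edges_def by auto
    ultimately show ?thesis by (simp only: image_image)
  qed
  have e_sub: "e \<subseteq> pts G" if "e \<in> edges G" for e using edge_subset[OF rG that] .
  have inj_e: "inj_on (image h) (edges G)"
    using inj_on_image_Pow[OF inj] e_sub by (auto intro: inj_on_subset)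
  \<comment> \<open>All three numbers count classes of relations on the points, so one transport
    along \<open>h\<close> covers them together.\<close>
  have transfer: "card (pts H // conn (map_prod h h ` R)) = card (pts G // conn R)"
    if R: "R \<subseteq> pts G \<times> pts G" for R
  proof (rule card_quotient_eq[symmetric, where h = h and k = "inv_into (pts G) h"])
    show "finite (pts G)" "finite (pts H)" using ribbon_graphD(1) rG rH by blast+
    show "h ` pts G \<subseteq> pts H" "inv_into (pts G) h ` pts H \<subseteq> pts G"
      using im inv_into_into[of _ h "pts G"] by auto
    show "R \<subseteq> pts G \<times> pts G" by fact
    show "map_prod h h ` R \<subseteq> pts H \<times> pts H" using R im by auto
    show "(h p, h q) \<in> conn (map_prod h h ` R)" if "(p, q) \<in> R" for p q
      using that by (intro conn_incl) force
    show "(inv_into (pts G) h p, inv_into (pts G) h q) \<in> conn R" if "(p, q) \<in> map_prod h h ` R" for p q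
      using that R inj by (auto intro!: conn_incl)
    show "(inv_into (pts G) h (h p), p) \<in> conn R" if "p \<in> pts G" for p
      using that inj by simp
    show "(h (inv_into (pts G) h p), p) \<in> conn (map_prod h h ` R)" if "p \<in> pts H" for p
      using that im by (simp add: f_inv_into_f)
  qed
  have clq: "clq (image h ` A) = map_prod h h ` clq A" for A
    unfolding clq_def by (auto simp: image_iff)
  show ?thesis
  proof (rule U_poly_cong)
    show "bij_betw (image h) (edges G) (edges H)" using inj_e edges by (simp add: bij_betw_def)
    show "finite (edges G)" using finite_edges[OF rG] .
    fix A assume A: "A \<subseteq> edges G"
    have mem: "h x \<in> \<Union>(image h ` A) \<longleftrightarrow> x \<in> \<Union>A" if "x \<in> pts G" for x
    proof -
      have "h x \<in> h ` e \<longleftrightarrow> x \<in> e" if "e \<in> A" for e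
        using inj_on_image_mem_iff[OF inj \<open>x \<in> pts G\<close>] e_sub A that by blast
      then show ?thesis by blast
    qed
    have gr_h: "gr (pts H) g = map_prod h h ` gr (pts G) g'"
      if "\<And>x. x \<in> pts G \<Longrightarrow> g (h x) = h (g' x)" for g g'
      unfolding gr_def im[symmetric] using that by (auto simp: image_iff)
    have "(if h x \<in> \<Union>(image h ` A) then side H (h x) else seg H (h x)) =
        h (if x \<in> \<Union>A then side G x else seg G x)" if "x \<in> pts G" for x
      by (cases "x \<in> \<Union>A") (simp_all only: mem[OF that] hom[OF that] if_True if_False)
    then have gr_sides: "gr (pts H) (\<lambda>x. if x \<in> \<Union>(image h ` A) then side H x else seg H x) =
        map_prod h h ` gr (pts G) (\<lambda>x. if x \<in> \<Union>A then side G x else seg G x)"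
      by (rule gr_h)
    have gr_arc: "gr (pts H) (arc H) = map_prod h h ` gr (pts G) (arc G)"
      by (rule gr_h) (simp only: hom)
    have "gr (pts H) (arc H) \<union> gr (pts H) (\<lambda>x. if x \<in> \<Union>(image h ` A) then side H x else seg H x) =
      map_prod h h ` (gr (pts G) (arc G) \<union> gr (pts G) (\<lambda>x. if x \<in> \<Union>A then side G x else seg G x))"
      unfolding image_Un gr_arc gr_sides ..
    then have "vnum H (image h ` A) = vnum G A"
      using transfer[OF state_relations_subset(1)[OF G A]] by (simp add: vnum_def)
    moreover have "vcnum H (image h ` A) = vcnum G A"
      using transfer[OF state_relations_subset(2)[OF G A]]
      by (simp add: vcnum_def col crel_image clq image_Un)
    moreover have "edges H - image h ` A = image h ` (edges G - A)"
      using inj_on_image_set_diff[OF inj_e _ A, of "edges G"] edges by simp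
    then have "bcnum H (image h ` A) = bcnum G A"
      using transfer[OF state_relations_subset(3)[OF G A]]
      by (simp add: bcnum_def col crel_image clq image_Un)
    ultimately show "state H (image h ` A) = state G A" by (simp add: state_def)
  qed
qed

text \<open>The two points of the mark are retracted onto their neighbours along the arcs.
  Retraction and inclusion are inverse up to connectedness for each of the three relations.\<close>

lemma U_poly_drop_mark:
  assumes G: "coloured_ribbon_graph G" and H: "coloured_ribbon_graph H" and dm: "drop_mark G H"
  shows "U_poly H = U_poly G"
proof -
  note rG = coloured_ribbon_graphD(1)[OF G] and rH = coloured_ribbon_graphD(1)[OF H]
  obtain x y where x: "x \<in> pts G" and y: "seg G x = y" "side G x = y" and ne: "arc G x \<noteq> y"
    and H_eq: "H = \<lparr>pts = pts G - {x, y},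
             arc = (arc G)(arc G x := arc G y, arc G y := arc G x),
             seg = seg G, side = side G,
             vcol = (\<lambda>c. (\<lambda>v. v - {x, y}) ` c) ` vcol G,
             bcol = (\<lambda>c. (\<lambda>v. v - {x, y}) ` c) ` bcol G\<rparr>"
    using dm unfolding drop_mark_def by blast
  note arc = fpf_involution_onD[OF ribbon_graphD(2)[OF rG]]
  note seg = fpf_involution_onD[OF ribbon_graphD(3)[OF rG]]
  note side = fpf_involution_onD[OF ribbon_graphD(4)[OF rG]]
  let ?P = "pts G" and ?P' = "pts G - {x, y}"
  have H_simps: "pts H = ?P'" "arc H = (arc G)(arc G x := arc G y, arc G y := arc G x)"
    "seg H = seg G" "side H = side G"
    "crel (vcol H) = crel (vcol G) \<inter> ?P' \<times> ?P'" "crel (bcol H) = crel (bcol G) \<inter> ?P' \<times> ?P'"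
  proof -
    have *: "crel ((\<lambda>c. (\<lambda>v. v - {x, y}) ` c) ` K) = crel K \<inter> (UNIV - {x, y}) \<times> (UNIV - {x, y})" for K
      unfolding crel_def by auto
    show "crel (vcol H) = crel (vcol G) \<inter> ?P' \<times> ?P'"
      using crel_subset[OF coloured_ribbon_graphD(4,2)[OF G]] * H_eq by auto
    show "crel (bcol H) = crel (bcol G) \<inter> ?P' \<times> ?P'"
      using crel_subset[OF coloured_ribbon_graphD(5,3)[OF G]] * H_eq by auto
  qed (simp_all add: H_eq)
  have yP: "y \<in> ?P" "y \<noteq> x" "seg G y = x" "side G y = x" using seg[OF x] side[OF x] y by auto
  have a: "arc G x \<in> ?P'" "arc G y \<in> ?P'"
    using arc(1,2)[OF x] arc(1,2)[OF yP(1)] arc(3)[OF x] arc(3)[OF yP(1)] ne by auto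
  have mark: "x \<notin> e" "y \<notin> e" if "e \<in> edges G" for e
    using edge_eq(2)[OF rG that] y yP by metis+
  have edges: "edges H = edges G"
  proof -
    have "p \<in> ?P' \<and> seg G p \<noteq> side G p \<longleftrightarrow> p \<in> ?P \<and> seg G p \<noteq> side G p" for p
      using y yP by auto
    then show ?thesis unfolding edges_def H_simps by (simp only:)
  qed
  \<comment> \<open>The neighbour along \<open>arc\<close> remains since
    \<open>arc G x \<noteq> y\<close>. An arc lies on both a vertex and a boundary component, so one
    retraction suits both colourings.\<close>
  define r where "r p = (if p = x then arc G x else if p = y then arc G y else p)" for p
  have rP: "r p \<in> ?P'" if "p \<in> ?P" for p using that a by (simp add: r_def)
  have r_id: "r p = p" if "p \<in> ?P'" for p using that by (simp add: r_def)
  have retract: "card (?P // conn R) = card (?P' // conn R')"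
    if R: "R \<subseteq> ?P \<times> ?P" "R' \<subseteq> ?P' \<times> ?P'" and RR': "\<And>p q. (p, q) \<in> R \<Longrightarrow> (r p, r q) \<in> conn R'"
      and R'R: "R' \<subseteq> conn R" and arcs: "(arc G x, x) \<in> conn R" "(arc G y, y) \<in> conn R" for R R'
  proof (rule card_quotient_eq[where h = r and k = id])
    show "finite ?P" "finite ?P'" using ribbon_graphD(1)[OF rG] by simp_all
    show "r ` ?P \<subseteq> ?P'" using rP by blast
    show "(id (r p), p) \<in> conn R" for p using arcs by (simp add: r_def)
    show "(r (id p), p) \<in> conn R'" if "p \<in> ?P'" for p using r_id[OF that] by simp
  qed (use R RR' R'R in auto)
  \<comment> \<open>The map \<open>g\<close> is left open to serve both colourings:
    \<open>seg\<close> for vertices, \<open>side\<close> for boundary components. Edges avoid the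
    mark, so the retraction fixes their cliques.\<close>
  have colours: "card (?P // conn (crel K \<union> clq B)) = card (?P' // conn (crel K \<inter> ?P' \<times> ?P' \<union> clq B))"
    if B: "B \<subseteq> edges G" and sub: "crel K \<union> clq B \<subseteq> ?P \<times> ?P"
      and K: "gr ?P (arc G) \<union> gr ?P g \<subseteq> ?P \<times> ?P" "partition_on (?P // conn (gr ?P (arc G) \<union> gr ?P g)) K"
    for K B g
  proof -
    have cB: "p \<in> ?P'" "q \<in> ?P'" if "(p, q) \<in> clq B" for p q
    proof -
      obtain e where "e \<in> edges G" "p \<in> e" "q \<in> e" using \<open>(p, q) \<in> clq B\<close> B by (auto simp: clq_def)
      moreover have "p \<in> ?P" "q \<in> ?P" using that sub by blast+
      ultimately show "p \<in> ?P'" "q \<in> ?P'" using mark by blast+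
    qed
    have tr: "(p, q) \<in> crel K" if "p \<in> ?P" "(p, q) \<in> conn (crel K)" for p q
      using conn_crel_iff[OF partition_on_quotient_conn[OF K(1)] K(2) that(1)] that(2) by blast
    have arcs: "(p, arc G p) \<in> conn (crel K)" if "p \<in> ?P" for p
      using conn_subset_crel[OF K(2,1)] conn_incl[of p "arc G p" "gr ?P (arc G) \<union> gr ?P g"] that
      by auto
    have r_crel: "(p, r p) \<in> conn (crel K)" if "p \<in> ?P" for p
      by (cases "p = x"; cases "p = y") (use arcs[OF that] in \<open>simp_all add: r_def\<close>)
    show ?thesis
    proof (rule retract)
      show "crel K \<inter> ?P' \<times> ?P' \<union> clq B \<subseteq> ?P' \<times> ?P'" using cB by auto
      show "(arc G x, x) \<in> conn (crel K \<union> clq B)" "(arc G y, y) \<in> conn (crel K \<union> clq B)"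
        using conn_mono[of "crel K" "crel K \<union> clq B"] conn_sym[OF arcs[OF x]] conn_sym[OF arcs[OF yP(1)]]
        by auto
      show "crel K \<inter> ?P' \<times> ?P' \<union> clq B \<subseteq> conn (crel K \<union> clq B)" by (auto intro: conn_incl)
      fix p q assume pq: "(p, q) \<in> crel K \<union> clq B"
      then have P: "p \<in> ?P" "q \<in> ?P" using sub by auto
      show "(r p, r q) \<in> conn (crel K \<inter> ?P' \<times> ?P' \<union> clq B)"
      proof (cases "(p, q) \<in> crel K")
        case True
        then have "(r p, r q) \<in> conn (crel K)"
          using conn_trans[OF conn_sym[OF r_crel[OF P(1)]] conn_trans[OF conn_incl r_crel[OF P(2)]]]
          by blast
        then have "(r p, r q) \<in> crel K" using tr rP[OF P(1)] by blast
        then show ?thesis using rP[OF P(1)] rP[OF P(2)] by (intro conn_incl) blast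
      next
        case False
        then have "(p, q) \<in> clq B" using pq by blast
        then show ?thesis using cB r_id by (intro conn_incl) auto
      qed
    qed (rule sub)
  qed
  have "state H A = state G A" if A: "A \<subseteq> edges G" for A
  proof -
    note sub = state_relations_subset[OF G A]
    define s where "s = (\<lambda>p. if p \<in> \<Union>A then side G p else seg G p)"
    let ?R = "gr ?P (arc G) \<union> gr ?P s" and ?R' = "gr ?P' (arc H) \<union> gr ?P' s"
    have sub': "?R' \<subseteq> ?P' \<times> ?P'"
      using state_relations_subset(1)[OF H] A unfolding edges H_simps(1,3,4) s_def by blast
    have arc_ne: "arc G x \<noteq> arc G y" using arc(3)[OF x] arc(3)[OF yP(1)] yP(2) by metis
    have arc_H: "arc H (arc G x) = arc G y" "arc H (arc G y) = arc G x"
      "\<And>p. p \<noteq> arc G x \<Longrightarrow> p \<noteq> arc G y \<Longrightarrow> arc H p = arc G p"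
      using arc_ne by (simp_all add: H_simps(2))
    have s_mark: "s x = y" "s y = x" using y yP by (simp_all add: s_def)
    have R: "(p, arc G p) \<in> conn ?R" "(p, s p) \<in> conn ?R" if "p \<in> ?P" for p
      using that by (intro conn_incl; simp)+
    have R': "(p, arc H p) \<in> conn ?R'" "(p, s p) \<in> conn ?R'" if "p \<in> ?P'" for p
      using that by (intro conn_incl; simp)+
    have "vnum H A = vnum G A"
      unfolding vnum_def H_simps(1,3,4) s_def[symmetric]
    proof (rule retract[symmetric, OF sub(1)[folded s_def] sub'])
      fix p q assume "(p, q) \<in> ?R"
      then consider "p \<in> ?P" "q = arc G p" | "p \<in> ?P" "q = s p" by auto
      then show "(r p, r q) \<in> conn ?R'"
      proof cases
        case 1
        consider "p = x \<or> p = y" | "p = arc G x" | "p = arc G y"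
          | "p \<in> ?P'" "p \<noteq> arc G x" "p \<noteq> arc G y"
          using 1(1) by blast
        then show ?thesis
        proof cases
          case 1
          then have "r q = r p" using \<open>q = _\<close> a yP(2) by (auto simp: r_def)
          then show ?thesis by simp
        next
          case 2
          then have "r q = r p" using \<open>q = _\<close> arc(3)[OF x] a by (simp add: r_def)
          then show ?thesis by simp
        next
          case 3
          then have "r q = r p" using \<open>q = _\<close> arc(3)[OF yP(1)] a yP(2) by (simp add: r_def)
          then show ?thesis by simp
        next
          case 4
          then have "arc G p \<in> ?P'" using arc(1,3)[of p] by (metis Diff_iff insertE singletonD)
          then show ?thesis using R'(1)[OF 4(1)] 4 \<open>q = _\<close> arc_H(3) r_id by simp
        qed
      next
        case 2
        \<comment> \<open>The link between \<open>x\<close> and \<open>y\<close> along the mark is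
          carried to the new arc between \<open>arc G x\<close> and \<open>arc G y\<close>.\<close>
        consider "p = x" | "p = y" | "p \<in> ?P'" using 2(1) by blast
        then show ?thesis
        proof cases
          case 1
          then show ?thesis using R'(1)[OF a(1)] 2(2) s_mark yP(2) arc_H by (simp add: r_def)
        next
          case 2
          then show ?thesis using R'(1)[OF a(2)] \<open>q = _\<close> s_mark yP(2) arc_H by (simp add: r_def)
        next
          case 3
          then have "(p, s p) \<in> ?R'" by simp
          then have "s p \<in> ?P'" using sub' by blast
          then show ?thesis using R'(2)[OF 3] 2(2) r_id 3 by simp
        qed
      qed
    next
      \<comment> \<open>Conversely, the new arc is the old path through \<open>x\<close> and
        \<open>y\<close>.\<close>
      have xy: "(arc G x, arc G y) \<in> conn ?R"
        using conn_trans[OF conn_sym[OF R(1)[OF x]] conn_trans[OF R(2)[OF x]]] R(1)[OF yP(1)] s_mark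
        by simp
      show "?R' \<subseteq> conn ?R"
      proof clarify
        fix p q assume "(p, q) \<in> ?R'"
        then consider "p \<in> ?P'" "q = arc H p" | "p \<in> ?P'" "q = s p" by auto
        then show "(p, q) \<in> conn ?R"
        proof cases
          case 1
          then show ?thesis
            using xy conn_sym[OF xy] R(1)[of p] arc_H
            by (cases "p = arc G x"; cases "p = arc G y") simp_all
        next
          case 2
          then show ?thesis using R(2)[of p] by simp
        qed
      qed
      show "(arc G x, x) \<in> conn ?R" "(arc G y, y) \<in> conn ?R"
        using R(1)[OF x] R(1)[OF yP(1)] conn_sym by metis+
    qed
    moreover have "vcnum H A = vcnum G A"
      unfolding vcnum_def H_simps
      using colours[OF A sub(2) gr_Un_subset[OF ribbon_graphD(2,3)[OF rG]]]
        coloured_ribbon_graphD(2)[OF G, unfolded verts_def curves_eq_quotient[OF ribbon_graphD(2,3)[OF rG]]]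
      by simp
    moreover have "bcnum H A = bcnum G A"
      unfolding bcnum_def H_simps edges
      using colours[OF Diff_subset sub(3) gr_Un_subset[OF ribbon_graphD(2,4)[OF rG]]]
        coloured_ribbon_graphD(3)[OF G, unfolded bounds_def curves_eq_quotient[OF ribbon_graphD(2,4)[OF rG]]]
      by simp
    ultimately show ?thesis by (simp add: state_def)
  qed
  then show ?thesis
    using U_poly_cong[of id G H] finite_edges[OF rG] edges by simp
qed

lemma U_poly_equivalent:
  assumes "equivalent G H"
  shows "U_poly G = U_poly H"
  using assms[unfolded equivalent_def]
proof (induction rule: equivclp_induct)
  case (step H K)
  then show ?case using U_poly_isomorphic U_poly_drop_mark by metis
qed simp

theorem theorem3p2:
  shows "\<exists>U :: 'a coloured_ribbon \<Rightarrow> upoly.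
    (\<forall>G H. coloured_ribbon_graph G \<and> coloured_ribbon_graph H \<and> equivalent G H \<longrightarrow> U G = U H) \<and>
    (\<forall>G e i j. coloured_ribbon_graph G \<and> has_type G e (i, j) \<longrightarrow>
       U G = coeff_a i * U (delete e G) + coeff_b j * U (contract e G)) \<and>
    (\<forall>G. coloured_ribbon_graph G \<and> edges G = {} \<longrightarrow>
       U G = X Alpha ^ card (vcol G) * X Beta ^ card (bcol G) * X Gamma ^ card (verts G)) \<and>
    (\<forall>G p. coloured_ribbon_graph G \<longrightarrow> (evaluates G p \<longleftrightarrow> p = U G))"
proof (intro exI[of _ U_poly] conjI allI impI; (elim conjE)?)
  fix G H :: "'a coloured_ribbon" assume "equivalent G H"
  then show "U_poly G = U_poly H" by (rule U_poly_equivalent)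
next
  fix G :: "'a coloured_ribbon" and p assume "coloured_ribbon_graph G"
  then show "evaluates G p \<longleftrightarrow> p = U_poly G" using evaluates_U_poly evaluates_unique by blast
qed (rule U_poly_recursion U_poly_edgeless; assumption)+

end
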